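(* Let $X$ be a finite multiset of nonzero vectors spanning $\mathbb{R}^n$, let $I\in\mathbb{I}(X)$, and let $\prec$ be a total order on $X$ in which the elements of $I$ come last, i.e. $x\prec y$ for all $x\in X\setminus I$ and $y\in I$. Then: 1. $\dim\mathcal{P}_-(X,I)=\#\mathbb{B}_-(X,I)$. 2. $\mathcal{P}_-(X,I)=\ker\mathcal{I}_-(X,I)$.
   Context: **Polynomials.** $\Pi=\mathbb{C}[t_1,\dots,t_n]$. For $p\in\Pi$, $p(D)$ is the constant-coefficient differential operator obtained by substituting $\partial/\partial t_i$ for $t_i$. For a homogeneous ideal $J\subset\Pi$, $\ker J:=\{q\in\Pi:\ p(D)q=0\text{ for all }p\in J\}$. For $x\in\mathbb{R}^n$, $p_x(t):=x\cdot t$ (standard inner product). For a finite multiset $Y$ of vectors, $p_Y:=\prod_{y\in Y}p_y$, with $p_\emptyset=1$. **The multiset $X$.** $X$ is a finite multiset of nonzero vectors spanning $\mathbb{R}^n$ (the columns of an $n\times N$ matrix of rank $n$). Repeated vectors are distinct elements of $X$, subsets of $X$ are submultisets, and cardinalities count multiplicities. $\mathbb{B}(X)$ is the collection of subsets of $X$ that are bases of $\mathbb{R}^n$. $\mathbb{I}(X)$ is the collection of all linearly independent subsets of $X$ (including $\emptyset$). For a subspace $S$, $X\setminus S$ is the multiset of elements of $X$ not in $S$. For $b\in X$, $X\setminus b$ is $X$ with the element $b$ removed (once). **The spaces.** For any finite multiset $A$ of nonzero vectors in $\mathbb{R}^n$, $\mathcal{P}(A):=\mathrm{span}\{p_Y:\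 Y\subset A,\ \mathrm{rank}(A\setminus Y)=n\}$ (so $\mathcal{P}(A)=0$ if $\mathrm{rank}\,A<n$). For $I\in\mathbb{I}(X)$, $$\mathcal{P}_-(X,I):=\bigcap_{b\in I}\mathcal{P}(X\setminus b),$$ with the convention $\mathcal{P}_-(X,\emptyset)=\mathcal{P}(X)$. **$I$-internal bases.** Let $B\in\mathbb{B}(X)$. An element $b\in B$ is $I$-internally active in $B$ if $b\in I$ and $b$ is the $\prec$-maximal element of $X\setminus\mathrm{span}(B\setminus b)$. $B$ is $I$-internal if no $b\in B$ is $I$-internally active in $B$. $\mathbb{B}_-(X,I)$ is the set of all $I$-internal bases. **Ideals.** A facet hyperplane of $X$ is an $(n-1)$-dimensional subspace spanned by a subset of $X$. $\mathcal{F}(X)$ is the set of these. For $F\in\mathcal{F}(X)$, $\eta_F$ is a nonzero normal to $F$ (unique up to scalar) and $m(F):=\#(X\setminus F)$. Let $\mathcal{F}(X,I):=\{F\in\mathcal{F}(X):\ I\not\subset F\}$, let $\mathcal{I}(X):=\mathrm{Ideal}\{p_{\eta_F}^{m(F)}:\ F\in\mathcal{F}(X)\}$, and $$\mathcal{I}_-(X,I):=\mathrm{Ideal}\big(\mathcal{I}(X)\cup\{p_{\eta_F}^{m(F)-1}:\ F\in\mathcal{F}(X,I)\}\big).$$ *)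

theory Defs
  imports "HOL-Analysis.Analysis" "HOL-Library.Poly_Mapping"
begin

section \<open>Polynomials in finitely many variables\<close>

text \<open>
  An exponent vector is a finitely supported map from the index type to the naturals, and a
  polynomial is a finitely supported map from exponent vectors to coefficients; the ring
  structure is the convolution product of \<^theory>\<open>HOL-Library.Poly_Mapping\<close>.  With the
  index type \<open>'n\<close> of \<open>real ^ 'n\<close>, the type \<open>'n cpoly\<close> is the ring of complex polynomials in
  one variable for each coordinate.
\<close>

type_synonym 'n cpoly = "('n \<Rightarrow>\<^sub>0 nat) \<Rightarrow>\<^sub>0 complex"

definition cscale :: "complex \<Rightarrow> 'n cpoly \<Rightarrow> 'n cpoly" where
  "cscale c p = Poly_Mapping.single 0 c * p"

interpretation cpoly: vector_space "cscale :: complex \<Rightarrow> 'n cpoly \<Rightarrow> 'n cpoly"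
  by unfold_locales
    (simp_all add: cscale_def algebra_simps single_add mult_single flip: mult.assoc)

text \<open>The submodules of a commutative ring over itself are its ideals.\<close>

interpretation cpoly_ideal: module "(*) :: 'n cpoly \<Rightarrow> 'n cpoly \<Rightarrow> 'n cpoly"
  by unfold_locales (simp_all add: algebra_simps)

definition generated_ideal :: "'n cpoly set \<Rightarrow> 'n cpoly set" where
  "generated_ideal G = cpoly_ideal.span G"

definition var :: "'n \<Rightarrow> 'n cpoly" where
  "var i = Poly_Mapping.single (Poly_Mapping.single i 1) 1"

definition partial :: "'n \<Rightarrow> 'n cpoly \<Rightarrow> 'n cpoly" where
  "partial i q = (\<Sum>a\<in>Poly_Mapping.keys q. Poly_Mapping.single (a - Poly_Mapping.single i 1)
     (of_nat (Poly_Mapping.lookup a i) * Poly_Mapping.lookup q a))"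

lemma lookup_partial:
  "Poly_Mapping.lookup (partial i q) a
    = of_nat (Suc (Poly_Mapping.lookup a i)) * Poly_Mapping.lookup q (a + Poly_Mapping.single i 1)"
proof -
  let ?b = "a + Poly_Mapping.single i 1"
  have shift: "c = ?b" if "c - Poly_Mapping.single i 1 = a" "Poly_Mapping.lookup c i \<noteq> 0" for c
  proof (rule poly_mapping_eqI)
    fix k show "Poly_Mapping.lookup c k = Poly_Mapping.lookup ?b k"
      using that by (auto simp: lookup_add lookup_minus lookup_single when_def)
  qed
  have "Poly_Mapping.lookup (partial i q) a = (\<Sum>c\<in>Poly_Mapping.keys q.
      of_nat (Poly_Mapping.lookup c i) * Poly_Mapping.lookup q c
        when c - Poly_Mapping.single i 1 = a)"
    by (simp add: partial_def lookup_sum lookup_single)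
  also have "\<dots> = (\<Sum>c\<in>Poly_Mapping.keys q. if c = ?b then
      of_nat (Poly_Mapping.lookup ?b i) * Poly_Mapping.lookup q ?b else 0)"
    by (intro sum.cong refl) (use shift in \<open>auto simp: when_def\<close>)
  also have "\<dots> = of_nat (Poly_Mapping.lookup ?b i) * Poly_Mapping.lookup q ?b"
    by (simp add: in_keys_iff)
  finally show ?thesis
    by (simp add: lookup_add)
qed

lemma partial_commute: "partial i (partial j q) = partial j (partial i q)"
  by (rule poly_mapping_eqI)
    (simp add: lookup_partial lookup_add lookup_single when_def ac_simps)

lemma comp_fun_commute_partial_power:
  fixes a :: "'n \<Rightarrow>\<^sub>0 nat"
  shows "comp_fun_commute (\<lambda>i. partial i ^^ Poly_Mapping.lookup a i)"
proof
  fix i j :: 'n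
  have 1: "partial i ((partial j ^^ n) q) = (partial j ^^ n) (partial i q)" for n and q :: "'n cpoly"
    by (induction n) (simp_all, metis partial_commute)
  have "(partial i ^^ m) ((partial j ^^ n) q) = (partial j ^^ n) ((partial i ^^ m) q)" for m n and q :: "'n cpoly"
    by (induction m) (simp_all add: 1)
  then show "(partial j ^^ Poly_Mapping.lookup a j) \<circ> (partial i ^^ Poly_Mapping.lookup a i)
      = (partial i ^^ Poly_Mapping.lookup a i) \<circ> (partial j ^^ Poly_Mapping.lookup a j)"
    by (simp add: fun_eq_iff)
qed

text \<open>
  The composition of the iterated partial derivatives in the exponent vector \<open>a\<close>; by the
  preceding lemma the order of composition is irrelevant, so the fold is well defined.
\<close>

definition monom_diff :: "('n::finite \<Rightarrow>\<^sub>0 nat) \<Rightarrow> 'n cpoly \<Rightarrow> 'n cpoly" where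
  "monom_diff a q = Finite_Set.fold (\<lambda>i. partial i ^^ Poly_Mapping.lookup a i) q UNIV"

text \<open>\<open>diff_op p q\<close> is $p(D)q$.\<close>

definition diff_op :: "'n::finite cpoly \<Rightarrow> 'n cpoly \<Rightarrow> 'n cpoly" where
  "diff_op p q = (\<Sum>a\<in>Poly_Mapping.keys p. cscale (Poly_Mapping.lookup p a) (monom_diff a q))"

definition ideal_ker :: "'n::finite cpoly set \<Rightarrow> 'n cpoly set" where
  "ideal_ker J = {q. \<forall>p\<in>J. diff_op p q = 0}"

definition lin_form :: "real ^ 'n \<Rightarrow> 'n::finite cpoly" where
  "lin_form x = (\<Sum>i\<in>UNIV. cscale (complex_of_real (x $ i)) (var i))"

section \<open>Multisets of vectors\<close>

text \<open>
  A finite multiset of vectors is a finite set \<open>E\<close> of labels together with a map \<open>v\<close> from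
  labels to vectors, so that repeated vectors are distinct elements and submultisets are
  subsets of \<open>E\<close>.  The map \<open>v\<close> is part of the data; a multiset with fewer elements is given
  by a smaller label set.
\<close>

definition prod_form :: "('e \<Rightarrow> real ^ 'n) \<Rightarrow> 'e set \<Rightarrow> 'n::finite cpoly" where
  "prod_form v Y = (\<Prod>y\<in>Y. lin_form (v y))"

definition vrank :: "('e \<Rightarrow> real ^ 'n::finite) \<Rightarrow> 'e set \<Rightarrow> nat" where
  "vrank v A = dim (v ` A)"

text \<open>Injectivity is needed because two equal vectors are linearly dependent.\<close>

definition indep_subsets :: "('e \<Rightarrow> real ^ 'n::finite) \<Rightarrow> 'e set \<Rightarrow> 'e set set" where
  "indep_subsets v E = {I. I \<subseteq> E \<and> inj_on v I \<and> independent (v ` I)}"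

definition basis_subsets :: "('e \<Rightarrow> real ^ 'n::finite) \<Rightarrow> 'e set \<Rightarrow> 'e set set" where
  "basis_subsets v E = {B \<in> indep_subsets v E. span (v ` B) = UNIV}"

definition outside :: "('e \<Rightarrow> real ^ 'n::finite) \<Rightarrow> 'e set \<Rightarrow> (real ^ 'n) set \<Rightarrow> 'e set" where
  "outside v E S = {x \<in> E. v x \<notin> S}"

section \<open>The polynomial spaces\<close>

definition P_space :: "('e \<Rightarrow> real ^ 'n::finite) \<Rightarrow> 'e set \<Rightarrow> 'n cpoly set" where
  "P_space v A = cpoly.span {prod_form v Y | Y. Y \<subseteq> A \<and> vrank v (A - Y) = CARD('n)}"

definition P_minus :: "('e \<Rightarrow> real ^ 'n::finite) \<Rightarrow> 'e set \<Rightarrow> 'e set \<Rightarrow> 'n cpoly set" where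
  "P_minus v E I = (if I = {} then P_space v E else (\<Inter>b\<in>I. P_space v (E - {b})))"

section \<open>Internal bases\<close>

text \<open>The order on the labels is given by a strict relation: \<open>(x, y) \<in> r\<close> means $x \prec y$.\<close>

definition internally_active ::
  "('e \<Rightarrow> real ^ 'n::finite) \<Rightarrow> 'e set \<Rightarrow> ('e \<times> 'e) set \<Rightarrow> 'e set \<Rightarrow> 'e set \<Rightarrow> 'e \<Rightarrow> bool" where
  "internally_active v E r I B b \<longleftrightarrow> b \<in> I
    \<and> b \<in> outside v E (span (v ` (B - {b})))
    \<and> (\<forall>y\<in>outside v E (span (v ` (B - {b}))). y \<noteq> b \<longrightarrow> (y, b) \<in> r)"

definition internal_bases ::
  "('e \<Rightarrow> real ^ 'n::finite) \<Rightarrow> 'e set \<Rightarrow> ('e \<times> 'e) set \<Rightarrow> 'e set \<Rightarrow> 'e set set" where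
  "internal_bases v E r I =
    {B \<in> basis_subsets v E. \<not> (\<exists>b\<in>B. internally_active v E r I B b)}"

section \<open>Facet hyperplanes and ideals\<close>

definition facets :: "('e \<Rightarrow> real ^ 'n::finite) \<Rightarrow> 'e set \<Rightarrow> (real ^ 'n) set set" where
  "facets v E = {F. subspace F \<and> dim F = CARD('n) - 1 \<and> (\<exists>Y\<subseteq>E. F = span (v ` Y))}"

definition facets_not_containing ::
  "('e \<Rightarrow> real ^ 'n::finite) \<Rightarrow> 'e set \<Rightarrow> 'e set \<Rightarrow> (real ^ 'n) set set" where
  "facets_not_containing v E I = {F \<in> facets v E. \<not> v ` I \<subseteq> F}"

definition facet_mult :: "('e \<Rightarrow> real ^ 'n::finite) \<Rightarrow> 'e set \<Rightarrow> (real ^ 'n) set \<Rightarrow> nat" where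
  "facet_mult v E F = card (outside v E F)"

text \<open>The ideals depend on a choice \<open>eta\<close> of a nonzero normal for each facet hyperplane.\<close>

definition facet_normals ::
  "('e \<Rightarrow> real ^ 'n::finite) \<Rightarrow> 'e set \<Rightarrow> ((real ^ 'n) set \<Rightarrow> real ^ 'n) \<Rightarrow> bool" where
  "facet_normals v E eta \<longleftrightarrow> (\<forall>F\<in>facets v E. eta F \<noteq> 0 \<and> (\<forall>x\<in>F. eta F \<bullet> x = 0))"

definition I_ideal ::
  "('e \<Rightarrow> real ^ 'n::finite) \<Rightarrow> 'e set \<Rightarrow> ((real ^ 'n) set \<Rightarrow> real ^ 'n) \<Rightarrow> 'n cpoly set" where
  "I_ideal v E eta = generated_ideal {lin_form (eta F) ^ facet_mult v E F | F. F \<in> facets v E}"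

text \<open>
  The truncated subtraction in the exponent is harmless: if the vectors span the whole space,
  then \<^const>\<open>facet_mult\<close> is positive.
\<close>

definition I_minus ::
  "('e \<Rightarrow> real ^ 'n::finite) \<Rightarrow> 'e set \<Rightarrow> ((real ^ 'n) set \<Rightarrow> real ^ 'n) \<Rightarrow> 'e set \<Rightarrow> 'n cpoly set" where
  "I_minus v E eta I = generated_ideal (I_ideal v E eta
    \<union> {lin_form (eta F) ^ (facet_mult v E F - 1) | F. F \<in> facets_not_containing v E I})"

end

theory Submission
  imports Defs
begin

text \<open>
  Write $\mathcal K(X,I)$ for the kernel of $\mathcal I_-(X,I)$ and call a basis inactive if it has
  no internally active element.  The proof compares $\mathcal P_-(X,I)$ with $\mathcal K(X,I)$ and
  bounds their dimensions from both sides by the number of inactive bases.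

  The upper bound $\dim\mathcal K(X,I)\le\#\mathbb B_-(X,I)$ (\<open>kernel_space_dim_le\<close>) is deletion and
  contraction of an element $x\notin I$.  Restriction of polynomials to the hyperplane orthogonal to
  $x$ maps $\mathcal K(X,I)$ into $\mathcal K(X/x,I)$; a polynomial in its kernel is $p_x g$, and
  Leibniz' rule turns the equation $D_\eta^{k+1}(p_xg)=0$, for $\eta$ not orthogonal to $x$, into
  $D_\eta^kg=0$, so that $g\in\mathcal K(X\setminus x,I)$.  On the side of the bases, those of $X/x$
  together with $x$ and those of $X\setminus x$ are disjoint sets of inactive bases of $X$.  The
  image of $I$ in $X/x$ may become dependent.  Therefore all notions are set up for an arbitrary set
  $I$ and arbitrary vectors, including zero, and the activity of $b$ is described without reference
  to $X\setminus I$: it means that all larger elements of $I$ lie in the hyperplane spanned by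
  $B\setminus b$.

  The opposite deletion-contraction inequality for $\mathcal P(X)$ is immediate from its generators
  (\<open>zonotopal_space_dim_ge\<close>), so $\mathcal P(X)=\mathcal K(X,\emptyset)$, and applying this to each
  $X\setminus b$ yields $\mathcal P_-(X,I)=\mathcal K(X,I)$ (\<open>kernel_space_eq\<close>).

  The lower bound for $\mathcal P_-(X,I)$ (\<open>kernel_space_dim_ge\<close>) adds the elements of $I$ in
  decreasing order.  If $b$ precedes all of $J$, then $\mathcal K(X,J\cup b)$ is cut out of
  $\mathcal K(X,J)$ by the operators $D_{\eta_F}^{m(F)-1}$, one for each facet $F\supseteq J$ not
  containing $b$.  Such an operator maps $\mathcal P_-(X,J)$ into $\mathcal P_-(X\cap F,J)$, whose
  dimension the upper bound controls.  The codimension is thus at most the number of inactive bases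
  $B'$ of the sets $X\cap F$; these inject, by adding $b$, into the bases that cease to be inactive
  when $b$ joins $J$.
\<close>

section \<open>Dimension bounds\<close>

text \<open>
  One-sided dimension bounds stay meaningful before finite-dimensionality is known, and
  \<^const>\<open>cpoly.dim\<close> is zero on infinite-dimensional spaces.
\<close>

definition dim_at_most :: "'n cpoly set \<Rightarrow> nat \<Rightarrow> bool" where
  "dim_at_most W k \<longleftrightarrow> (\<exists>T. finite T \<and> card T \<le> k \<and> W \<subseteq> cpoly.span T)"

definition dim_at_least :: "'n cpoly set \<Rightarrow> nat \<Rightarrow> bool" where
  "dim_at_least W k \<longleftrightarrow> (\<exists>A\<subseteq>W. finite A \<and> cpoly.independent A \<and> k \<le> card A)"

lemma dim_at_most_mono: "dim_at_most W k \<Longrightarrow> V \<subseteq> W \<Longrightarrow> k \<le> l \<Longrightarrow> dim_at_most V l"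
  unfolding dim_at_most_def by (elim exE, rule exI, auto)

lemma dim_at_least_mono:
  assumes "dim_at_least W k" "W \<subseteq> V" "l \<le> k"
  shows "dim_at_least V l"
proof -
  obtain A where "A \<subseteq> W" "finite A" "cpoly.independent A" "k \<le> card A"
    using assms(1) by (auto simp: dim_at_least_def)
  then show ?thesis
    unfolding dim_at_least_def using assms(2,3) by (intro exI[of _ A]) auto
qed

lemma dim_at_least_0: "dim_at_least W 0"
  unfolding dim_at_least_def by (intro exI[of _ "{}"]) (simp add: cpoly.independent_empty)

lemma independent_card_le_dim_at_most:
  assumes "dim_at_most W k" "cpoly.independent A" "A \<subseteq> W"
  shows "finite A \<and> card A \<le> k"
proof -
  obtain T where "finite T" "card T \<le> k" "W \<subseteq> cpoly.span T"
    using assms(1) by (auto simp: dim_at_most_def)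
  then show ?thesis
    using cpoly.independent_span_bound[of T A] assms by fastforce
qed

lemma dim_eqI:
  assumes "dim_at_most W k" "dim_at_least W k"
  shows "cpoly.dim W = k"
proof -
  obtain B where B: "B \<subseteq> W" "cpoly.independent B" "W \<subseteq> cpoly.span B"
    using cpoly.maximal_independent_subset[of W] by blast
  then have fin: "finite B" and le: "card B \<le> k"
    using independent_card_le_dim_at_most[OF assms(1)] by auto
  obtain A where A: "A \<subseteq> W" "cpoly.independent A" "k \<le> card A"
    using assms(2) by (auto simp: dim_at_least_def)
  then have "card A \<le> card B"
    using cpoly.independent_span_bound[OF fin A(2)] B(3) by auto
  with A(3) le have "card B = k" by simp
  then show ?thesis
    using cpoly.basis_card_eq_dim[OF B(1,3,2)] by simp
qed

lemma subspace_eq_of_dim: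
  assumes "dim_at_least V k" "dim_at_most W k" "V \<subseteq> W" "cpoly.subspace V"
  shows "V = W"
proof (rule ccontr)
  assume "V \<noteq> W"
  then obtain w where w: "w \<in> W" "w \<notin> V" using assms(3) by blast
  obtain A where A: "A \<subseteq> V" "finite A" "cpoly.independent A" "k \<le> card A"
    using assms(1) by (auto simp: dim_at_least_def)
  have "w \<notin> cpoly.span A"
    using w(2) cpoly.span_minimal[OF A(1) assms(4)] by blast
  then have "cpoly.independent (insert w A)" "w \<notin> A"
    using A(3) cpoly.independent_insertI cpoly.span_base by blast+
  moreover have "insert w A \<subseteq> W" using w A(1) assms(3) by blast
  ultimately have "Suc (card A) \<le> k"
    using independent_card_le_dim_at_most[OF assms(2), of "insert w A"] A(2) by simp
  with A(4) show False by simp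
qed

lemma dim_at_leastI_infinite:
  assumes "N \<subseteq> W" "cpoly.independent N" "infinite N"
  shows "dim_at_least W k"
proof -
  obtain M where "finite M" "card M = k" "M \<subseteq> N"
    using assms(3) infinite_arbitrarily_large by blast
  then show ?thesis
    unfolding dim_at_least_def using assms(1) cpoly.independent_mono[OF assms(2)]
    by (intro exI[of _ M]) auto
qed

text \<open>
  A subspace is generated by its intersection with the kernel together with lifts of a basis of
  its image.
\<close>

lemma lift_image_basis:
  assumes T: "Vector_Spaces.linear cscale cscale T" and W: "cpoly.subspace W"
    and le: "dim_at_most (T ` W) k"
  obtains C where "finite C" "card C \<le> k" "C \<subseteq> W"
    "\<And>w. w \<in> W \<Longrightarrow> \<exists>c\<in>cpoly.span C. T (w - c) = 0"
proof -
  interpret T: Vector_Spaces.linear cscale cscale T by (rule T)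
  obtain D where D: "D \<subseteq> T ` W" "cpoly.independent D" "T ` W \<subseteq> cpoly.span D"
    using cpoly.maximal_independent_subset[of "T ` W"] by blast
  have finD: "finite D" and cD: "card D \<le> k"
    using independent_card_le_dim_at_most[OF le D(2,1)] by auto
  obtain C where C: "C \<subseteq> W" "D = T ` C" "inj_on T C"
    using D(1) by (auto simp: subset_image_inj)
  have "\<exists>c\<in>cpoly.span C. T (w - c) = 0" if "w \<in> W" for w
  proof -
    have "T w \<in> T ` cpoly.span C"
      using that D(3) C(2) T.span_image[of C] by auto
    then obtain c where "c \<in> cpoly.span C" "T w = T c" by blast
    then show ?thesis by (auto simp: T.diff)
  qed
  then show ?thesis
    using that[of C] C finD cD by (simp add: card_image finite_image_iff)
qed

text \<open>
  Lifts of a basis of the image together with a spanning set of the kernel span the whole space.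
\<close>

lemma dim_at_most_exact:
  assumes T: "Vector_Spaces.linear cscale cscale T" and W: "cpoly.subspace W"
    and im: "dim_at_most (T ` W) k" and ker: "dim_at_most (W \<inter> {w. T w = 0}) l"
  shows "dim_at_most W (k + l)"
proof -
  obtain C where C: "finite C" "card C \<le> k" "C \<subseteq> W"
    "\<And>w. w \<in> W \<Longrightarrow> \<exists>c\<in>cpoly.span C. T (w - c) = 0"
    using lift_image_basis[OF T W im] by metis
  obtain S where S: "finite S" "card S \<le> l" "W \<inter> {w. T w = 0} \<subseteq> cpoly.span S"
    using ker by (auto simp: dim_at_most_def)
  have "w \<in> cpoly.span (C \<union> S)" if w: "w \<in> W" for w
  proof -
    obtain c where c: "c \<in> cpoly.span C" "T (w - c) = 0" using C(4)[OF w] by blast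
    have "c \<in> W" using c(1) cpoly.span_minimal[OF C(3) W] by blast
    then have "w - c \<in> cpoly.span S" using S(3) c(2) cpoly.subspace_diff[OF W w] by blast
    then have "c + (w - c) \<in> cpoly.span (C \<union> S)"
      using c(1) cpoly.span_mono[of C "C \<union> S"] cpoly.span_mono[of S "C \<union> S"]
      by (intro cpoly.span_add) auto
    then show ?thesis by simp
  qed
  moreover have "card (C \<union> S) \<le> k + l"
    using card_Un_le[of C S] C(2) S(2) by linarith
  ultimately show ?thesis
    unfolding dim_at_most_def using C(1) S(1) by (intro exI[of _ "C \<union> S"]) auto
qed

text \<open>
  The codimension of a kernel is at most the dimension of the image: a smaller kernel would make
  \<open>dim_at_most_exact\<close> contradict the lower bound for \<open>W\<close>.
\<close>

lemma dim_at_least_kernel: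
  assumes T: "Vector_Spaces.linear cscale cscale T" and W: "cpoly.subspace W"
    and im: "dim_at_most (T ` W) k" and W_ge: "dim_at_least W l"
  shows "dim_at_least (W \<inter> {w. T w = 0}) (l - k)"
proof -
  interpret T: Vector_Spaces.linear cscale cscale T by (rule T)
  obtain C where C: "finite C" "card C \<le> k" "C \<subseteq> W"
    "\<And>w. w \<in> W \<Longrightarrow> \<exists>c\<in>cpoly.span C. T (w - c) = 0"
    using lift_image_basis[OF T W im] by metis
  show ?thesis
  proof (rule ccontr)
    assume small: "\<not> dim_at_least (W \<inter> {w. T w = 0}) (l - k)"
    obtain N where N: "N \<subseteq> W \<inter> {w. T w = 0}" "cpoly.independent N" "W \<inter> {w. T w = 0} \<subseteq> cpoly.span N"
      using cpoly.maximal_independent_subset[of "W \<inter> {w. T w = 0}"] by blast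
    have fin: "finite N"
      using small dim_at_leastI_infinite[OF N(1,2)] by blast
    have "card N < l - k"
    proof (rule ccontr)
      assume "\<not> card N < l - k"
      then have "dim_at_least (W \<inter> {w. T w = 0}) (l - k)"
        unfolding dim_at_least_def using N(1,2) fin by (intro exI[of _ N]) simp
      with small show False by blast
    qed
    then have "dim_at_most (W \<inter> {w. T w = 0}) (l - k - 1)"
      unfolding dim_at_most_def using N(3) fin by (intro exI[of _ N]) auto
    then have "dim_at_most W (k + (l - k - 1))"
      by (rule dim_at_most_exact[OF T W im])
    moreover obtain A where "A \<subseteq> W" "finite A" "cpoly.independent A" "l \<le> card A"
      using W_ge by (auto simp: dim_at_least_def)
    ultimately have "l \<le> k + (l - k - 1)"
      using independent_card_le_dim_at_most[of W "k + (l - k - 1)" A] by linarith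
    with \<open>card N < l - k\<close> show False by linarith
  qed
qed

text \<open>
  A basis of the kernel extends to a basis of \<open>W\<close>; the added vectors span the image, hence there
  are at least \<open>k\<close> of them.
\<close>

lemma dim_at_least_exact:
  assumes T: "Vector_Spaces.linear cscale cscale T" and W: "cpoly.subspace W"
    and im: "dim_at_least (T ` W) k" and ker: "dim_at_least (W \<inter> {w. T w = 0}) l"
  shows "dim_at_least W (k + l)"
proof -
  interpret T: Vector_Spaces.linear cscale cscale T by (rule T)
  obtain D where D: "D \<subseteq> T ` W" "finite D" "cpoly.independent D" "k \<le> card D"
    using im by (auto simp: dim_at_least_def)
  obtain N where N: "N \<subseteq> W \<inter> {w. T w = 0}" "finite N" "cpoly.independent N" "l \<le> card N"
    using ker by (auto simp: dim_at_least_def)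
  obtain C where C: "C \<subseteq> W" "D = T ` C" "inj_on T C"
    using D(1) by (auto simp: subset_image_inj)
  show ?thesis
  proof (rule ccontr)
    assume small: "\<not> dim_at_least W (k + l)"
    obtain B where B: "N \<subseteq> B" "B \<subseteq> W" "cpoly.independent B" "W \<subseteq> cpoly.span B"
      using cpoly.maximal_independent_subset_extend[of N W] N(1,3) by auto
    have fin: "finite B"
      using small dim_at_leastI_infinite[OF B(2,3)] by blast
    have less: "card B < k + l"
    proof (rule ccontr)
      assume "\<not> card B < k + l"
      then have "dim_at_least W (k + l)"
        unfolding dim_at_least_def using B(2,3) fin by (intro exI[of _ B]) simp
      with small show False by blast
    qed
    have "T w \<in> cpoly.span (T ` (B - N))" if "w \<in> W" for w
    proof -
      have "T w \<in> cpoly.span (T ` B)" using that B(4) T.span_image[of B] by auto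
      also have "T ` B \<subseteq> insert 0 (T ` (B - N))" using N(1) by auto
      then have "cpoly.span (T ` B) \<subseteq> cpoly.span (T ` (B - N))"
        using cpoly.span_mono[of "T ` B" "insert 0 (T ` (B - N))"] by simp
      finally show ?thesis .
    qed
    then have "D \<subseteq> cpoly.span (T ` (B - N))" using D(1) by blast
    then have "card D \<le> card (T ` (B - N))"
      using cpoly.independent_span_bound[OF finite_imageI[OF finite_Diff[OF fin]] D(3)] by simp
    also have "\<dots> \<le> card B - card N"
      using card_image_le[of "B - N" T] fin B(1) N(2) by (simp add: card_Diff_subset)
    finally show False using less D(4) N(4) card_mono[OF fin B(1)] by linarith
  qed
qed

lemma dim_at_least_injective_image:
  assumes T: "Vector_Spaces.linear cscale cscale T" and inj: "\<And>w. T w = 0 \<Longrightarrow> w = 0"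
    and ge: "dim_at_least W k"
  shows "dim_at_least (T ` W) k"
proof -
  interpret T: Vector_Spaces.linear cscale cscale T by (rule T)
  have injT: "inj T" using inj T.inj_iff_eq_0 by blast
  obtain A where "A \<subseteq> W" "finite A" "cpoly.independent A" "k \<le> card A"
    using ge by (auto simp: dim_at_least_def)
  then show ?thesis
    unfolding dim_at_least_def using injT T.independent_injective_image[of A] inj_on_subset[OF injT]
    by (intro exI[of _ "T ` A"]) (auto simp: card_image)
qed

lemma dim_at_most_image:
  assumes T: "Vector_Spaces.linear cscale cscale T" and le: "dim_at_most W k"
  shows "dim_at_most (T ` W) k"
proof -
  interpret T: Vector_Spaces.linear cscale cscale T by (rule T)
  obtain S where "finite S" "card S \<le> k" "W \<subseteq> cpoly.span S"
    using le by (auto simp: dim_at_most_def)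
  then show ?thesis
    unfolding dim_at_most_def using T.span_image[of S] card_image_le[of S T]
    by (intro exI[of _ "T ` S"]) auto
qed

section \<open>Polynomial calculus\<close>

text \<open>
  As a rewrite rule this instance is associativity from right to left, which undoes
  \<open>mult.assoc\<close>.
\<close>

declare cpoly_ideal.scale_scale [simp del]

lemma lookup_cscale: "Poly_Mapping.lookup (cscale c p) a = c * Poly_Mapping.lookup p a"
proof -
  have "cscale c p = Poly_Mapping.map ((*) c) p"
    unfolding cscale_def mult_map_scale_conv_mult ..
  then show ?thesis by (simp add: Poly_Mapping.map.rep_eq when_def)
qed

lemma cscale_mult_left: "cscale c p * q = cscale c (p * q)"
  and cscale_mult_right: "p * cscale c q = cscale c (p * q)"
  by (simp_all add: cscale_def algebra_simps)

lemma monomial_induct [case_names monomial add]: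
  assumes "\<And>a c. P (Poly_Mapping.single a c)" and "\<And>p q. P p \<Longrightarrow> P q \<Longrightarrow> P (p + q)"
  shows "P (q :: 'n cpoly)"
proof -
  have "P (\<Sum>a\<in>A. Poly_Mapping.single a (Poly_Mapping.lookup q a))" if "finite A" for A
    using that
  proof induction
    case empty
    show ?case using assms(1)[of 0 0] by simp
  qed (simp add: assms)
  moreover have "(\<Sum>a\<in>Poly_Mapping.keys q. Poly_Mapping.single a (Poly_Mapping.lookup q a)) = q"
    by (rule poly_mapping_eqI)
      (simp add: lookup_sum lookup_single when_def in_keys_iff)
  ultimately show ?thesis by (metis finite_keys)
qed

lemma prod_single_one:
  "finite A \<Longrightarrow> (\<Prod>i\<in>A. Poly_Mapping.single (f i) (1::complex)) = Poly_Mapping.single (\<Sum>i\<in>A. f i) 1"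
  by (induction rule: finite_induct) (simp_all add: mult_single)

lemma single_eq_prod_var:
  "Poly_Mapping.single a c = Poly_Mapping.single 0 c * (\<Prod>i\<in>UNIV. var i ^ Poly_Mapping.lookup a i)"
  for a :: "'n::finite \<Rightarrow>\<^sub>0 nat"
proof -
  have pow: "var i ^ k = Poly_Mapping.single (Poly_Mapping.single i k) (1::complex)" for i :: 'n and k
  proof (induction k)
    case (Suc k)
    then show ?case
      using single_add[of i 1 k] by (simp add: var_def mult_single)
  qed simp
  have "(\<Sum>i\<in>UNIV. Poly_Mapping.single i (Poly_Mapping.lookup a i)) = a"
    by (rule poly_mapping_eqI) (simp add: lookup_sum lookup_single when_def)
  then have "(\<Prod>i\<in>UNIV. var i ^ Poly_Mapping.lookup a i) = Poly_Mapping.single a (1::complex)"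
    unfolding pow by (simp only: prod_single_one[OF finite])
  then show ?thesis
    by (simp only: mult_single) simp
qed

lemma cpoly_induct [case_names const var add mult]:
  fixes q :: "'n::finite cpoly"
  assumes "\<And>c. P (Poly_Mapping.single 0 c)" "\<And>i. P (var i)"
    and "\<And>p q. P p \<Longrightarrow> P q \<Longrightarrow> P (p + q)" "\<And>p q. P p \<Longrightarrow> P q \<Longrightarrow> P (p * q)"
  shows "P q"
proof (induction q rule: monomial_induct)
  case (monomial a c)
  have one: "P 1" using assms(1)[of 1] by simp
  have pow: "P (var i ^ k)" for i k
    by (induction k) (simp_all add: one assms)
  have "P (\<Prod>i\<in>A. var i ^ Poly_Mapping.lookup a i)" if "finite A" for A
    using that by (induction rule: finite_induct) (simp_all add: one pow assms)
  then show ?case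
    by (subst single_eq_prod_var) (simp add: assms)
qed (rule assms)

lemma lin_form_add: "lin_form (x + y) = lin_form x + lin_form y"
  by (simp add: lin_form_def sum.distrib cpoly.scale_left_distrib)

lemma lin_form_scaleR: "lin_form (c *\<^sub>R x) = cscale (complex_of_real c) (lin_form x)"
  by (simp add: lin_form_def cpoly.scale_sum_right)

lemma lin_form_0 [simp]: "lin_form 0 = 0"
  by (simp add: lin_form_def)

lemma lin_form_diff: "lin_form (x - y) = lin_form x - lin_form y"
  using lin_form_add[of "x - y" y] by simp

lemma lin_form_axis: "lin_form (axis i 1) = var i"
proof -
  have "lin_form (axis i 1) = (\<Sum>j\<in>UNIV. if j = i then var j else 0)"
    unfolding lin_form_def by (intro sum.cong refl) (auto simp: axis_def)
  then show ?thesis by simp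
qed

lemma lin_form_sum: "lin_form (sum f A) = (\<Sum>a\<in>A. lin_form (f a))"
  by (induction A rule: infinite_finite_induct) (simp_all add: lin_form_add)

subsection \<open>Partial and directional derivatives\<close>

lemma partial_add: "partial i (p + q) = partial i p + partial i q"
  by (rule poly_mapping_eqI) (simp add: lookup_partial lookup_add algebra_simps)

lemma partial_cscale: "partial i (cscale c p) = cscale c (partial i p)"
  by (rule poly_mapping_eqI) (simp add: lookup_partial lookup_cscale)

lemma partial_0 [simp]: "partial i 0 = 0"
  by (simp add: partial_def)

lemma partial_single:
  "partial i (Poly_Mapping.single a c)
    = Poly_Mapping.single (a - Poly_Mapping.single i 1) (of_nat (Poly_Mapping.lookup a i) * c)"
  by (cases "c = 0") (simp_all add: partial_def)

lemma single_minus_unit_add: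
  assumes "Poly_Mapping.lookup a i \<noteq> (0::nat)"
  shows "a - Poly_Mapping.single i 1 + b = a + b - Poly_Mapping.single i 1"
  by (rule poly_mapping_eqI) (use assms in \<open>auto simp: lookup_add lookup_minus lookup_single when_def\<close>)

lemma partial_mult: "partial i (p * q) = partial i p * q + p * partial i q"
proof (induction p rule: monomial_induct)
  case (monomial a c)
  show ?case
  proof (induction q rule: monomial_induct)
    case (monomial b d)
    show ?case
    proof (cases "Poly_Mapping.lookup a i = 0")
      case a: True
      then show ?thesis
      proof (cases "Poly_Mapping.lookup b i = 0")
        case True
        with a show ?thesis by (simp add: mult_single partial_single lookup_add)
      next
        case False
        with a show ?thesis
          using single_minus_unit_add[OF False, of a]
          by (simp add: mult_single partial_single lookup_add algebra_simps)
      qed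
    next
      case a: False
      show ?thesis
      proof (cases "Poly_Mapping.lookup b i = 0")
        case True
        with a show ?thesis
          using single_minus_unit_add[OF a, of b]
          by (simp add: mult_single partial_single lookup_add algebra_simps)
      next
        case False
        show ?thesis
          using single_minus_unit_add[OF a, of b] single_minus_unit_add[OF False, of a]
          by (simp add: mult_single partial_single lookup_add algebra_simps flip: single_add)
      qed
    qed
  qed (simp add: partial_add algebra_simps)
qed (simp add: partial_add algebra_simps)

definition dir_deriv :: "real ^ 'n::finite \<Rightarrow> 'n cpoly \<Rightarrow> 'n cpoly" where
  "dir_deriv \<eta> q = (\<Sum>i\<in>UNIV. cscale (complex_of_real (\<eta> $ i)) (partial i q))"

lemma dir_deriv_add: "dir_deriv \<eta> (p + q) = dir_deriv \<eta> p + dir_deriv \<eta> q"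
  by (simp add: dir_deriv_def partial_add cpoly.scale_right_distrib sum.distrib)

lemma dir_deriv_cscale: "dir_deriv \<eta> (cscale c p) = cscale c (dir_deriv \<eta> p)"
  by (simp add: dir_deriv_def partial_cscale cpoly.scale_sum_right mult.commute)

lemma dir_deriv_mult: "dir_deriv \<eta> (p * q) = dir_deriv \<eta> p * q + p * dir_deriv \<eta> q"
  by (simp add: dir_deriv_def partial_mult cpoly.scale_right_distrib sum.distrib
      sum_distrib_left sum_distrib_right cscale_mult_left cscale_mult_right)

lemma dir_deriv_0 [simp]: "dir_deriv \<eta> 0 = 0"
  by (simp add: dir_deriv_def)

lemma dir_deriv_const [simp]: "dir_deriv \<eta> (Poly_Mapping.single 0 c) = 0"
  by (simp add: dir_deriv_def partial_single)

lemma dir_deriv_one [simp]: "dir_deriv \<eta> 1 = 0"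
  using dir_deriv_const[of \<eta> 1] by simp

lemma dir_deriv_var: "dir_deriv \<eta> (var i) = Poly_Mapping.single 0 (complex_of_real (\<eta> $ i))"
proof -
  have "dir_deriv \<eta> (var i) = (\<Sum>j\<in>UNIV. if j = i then cscale (complex_of_real (\<eta> $ j)) 1 else 0)"
    unfolding dir_deriv_def var_def
    by (intro sum.cong refl) (auto simp: partial_single lookup_single)
  then show ?thesis by (simp add: cscale_def)
qed

lemma dir_deriv_sum: "dir_deriv \<eta> (sum f A) = (\<Sum>a\<in>A. dir_deriv \<eta> (f a))"
  by (induction A rule: infinite_finite_induct) (simp_all add: dir_deriv_add)

lemma dir_deriv_lin_form: "dir_deriv \<eta> (lin_form x) = Poly_Mapping.single 0 (complex_of_real (\<eta> \<bullet> x))"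
proof -
  have const: "Poly_Mapping.single 0 c = cscale c 1" for c :: complex
    by (simp add: cscale_def)
  show ?thesis
    by (simp add: lin_form_def dir_deriv_sum dir_deriv_cscale dir_deriv_var inner_vec_def const
        cpoly.scale_sum_left mult.commute)
qed

lemma dir_deriv_pow_add: "(dir_deriv \<eta> ^^ k) (p + q) = (dir_deriv \<eta> ^^ k) p + (dir_deriv \<eta> ^^ k) q"
  by (induction k) (simp_all add: dir_deriv_add)

lemma linear_dir_deriv_pow: "Vector_Spaces.linear cscale cscale (dir_deriv \<eta> ^^ k)"
proof -
  have "(dir_deriv \<eta> ^^ k) (cscale c q) = cscale c ((dir_deriv \<eta> ^^ k) q)" for c q
    by (induction k) (simp_all add: dir_deriv_cscale)
  then show ?thesis by unfold_locales (simp_all add: dir_deriv_pow_add)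
qed

lemma dir_deriv_pow_zero [simp]: "(dir_deriv \<eta> ^^ k) 0 = 0"
  by (induction k) simp_all

lemma dir_deriv_pow_mono:
  assumes "(dir_deriv \<eta> ^^ k) q = 0" "k \<le> l"
  shows "(dir_deriv \<eta> ^^ l) q = 0"
proof -
  have "(dir_deriv \<eta> ^^ l) q = (dir_deriv \<eta> ^^ (l - k)) ((dir_deriv \<eta> ^^ k) q)"
    using assms(2) by (simp flip: funpow_add o_apply[of "_ ^^ _"])
  then show ?thesis by (simp add: assms(1))
qed

text \<open>
  Leibniz' rule for the power $k+l$: each term differentiates \<open>p\<close> at least \<open>k\<close> times or \<open>q\<close> at
  least \<open>l\<close> times.
\<close>

lemma dir_deriv_pow_mult_eq_0:
  assumes "(dir_deriv \<eta> ^^ k) p = 0" "(dir_deriv \<eta> ^^ l) q = 0"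
  shows "(dir_deriv \<eta> ^^ (k + l)) (p * q) = 0"
  using assms
proof (induction "k + l" arbitrary: k l p q)
  case 0
  then show ?case by simp
next
  case (Suc m)
  interpret Vector_Spaces.linear cscale cscale "dir_deriv \<eta> ^^ m"
    by (rule linear_dir_deriv_pow)
  have "(dir_deriv \<eta> ^^ m) (dir_deriv \<eta> p * q) = 0"
  proof (cases k)
    case 0
    with Suc.prems show ?thesis by simp
  next
    case (Suc k')
    then show ?thesis
      using Suc.hyps(1)[of k' l "dir_deriv \<eta> p" q] Suc.hyps(2) Suc.prems
      by (simp add: funpow_swap1)
  qed
  moreover have "(dir_deriv \<eta> ^^ m) (p * dir_deriv \<eta> q) = 0"
  proof (cases l)
    case 0
    with Suc.prems show ?thesis by simp
  next
    case (Suc l')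
    then show ?thesis
      using Suc.hyps(1)[of k l' p "dir_deriv \<eta> q"] Suc.hyps(2) Suc.prems
      by (simp add: funpow_swap1)
  qed
  ultimately show ?case
    by (simp add: Suc.hyps(2)[symmetric] funpow_Suc_right dir_deriv_mult add del: funpow.simps)
qed

text \<open>
  The polynomials annihilated by some power of the derivative are closed under the ring operations and
  contain the constants and the variables.
\<close>

lemma dir_deriv_nilpotent: "\<exists>k. (dir_deriv \<eta> ^^ k) q = 0"
proof (induction q rule: cpoly_induct)
  case (const c)
  have "(dir_deriv \<eta> ^^ 1) (Poly_Mapping.single 0 c) = 0" by simp
  then show ?case by blast
next
  case (var i)
  have "(dir_deriv \<eta> ^^ 2) (var i) = 0"
    by (simp add: numeral_2_eq_2 dir_deriv_var)
  then show ?case by blast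
next
  case (add p q)
  then obtain k l where "(dir_deriv \<eta> ^^ k) p = 0" "(dir_deriv \<eta> ^^ l) q = 0" by blast
  then have "(dir_deriv \<eta> ^^ max k l) p = 0" "(dir_deriv \<eta> ^^ max k l) q = 0"
    using dir_deriv_pow_mono max.cobounded1 max.cobounded2 by metis+
  then have "(dir_deriv \<eta> ^^ max k l) (p + q) = 0"
    by (simp add: dir_deriv_pow_add)
  then show ?case by blast
next
  case (mult p q)
  then show ?case using dir_deriv_pow_mult_eq_0 by blast
qed

lemma dir_deriv_pow_lin_form_mult:
  "(dir_deriv \<eta> ^^ Suc k) (lin_form x * g)
    = lin_form x * (dir_deriv \<eta> ^^ Suc k) g
      + cscale (of_nat (Suc k) * complex_of_real (\<eta> \<bullet> x)) ((dir_deriv \<eta> ^^ k) g)"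
proof (induction k)
  case 0
  show ?case by (simp add: dir_deriv_mult dir_deriv_lin_form cscale_def)
next
  case (Suc k)
  let ?c = "complex_of_real (\<eta> \<bullet> x)"
  have "(dir_deriv \<eta> ^^ Suc (Suc k)) (lin_form x * g) = dir_deriv \<eta> ((dir_deriv \<eta> ^^ Suc k) (lin_form x * g))"
    by simp
  also have "\<dots> = lin_form x * (dir_deriv \<eta> ^^ Suc (Suc k)) g
     + (cscale ?c ((dir_deriv \<eta> ^^ Suc k) g) + cscale (of_nat (Suc k) * ?c) ((dir_deriv \<eta> ^^ Suc k) g))"
    unfolding Suc.IH
    by (simp add: dir_deriv_add dir_deriv_mult dir_deriv_lin_form dir_deriv_cscale cscale_def add_ac)
  also have "\<dots> = lin_form x * (dir_deriv \<eta> ^^ Suc (Suc k)) g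
     + cscale (of_nat (Suc (Suc k)) * ?c) ((dir_deriv \<eta> ^^ Suc k) g)"
    by (simp add: algebra_simps flip: cpoly.scale_left_distrib)
  finally show ?case .
qed

text \<open>
  If $D^jg$ is the last nonvanishing derivative of $g$ and $j\ge k$, then
  $D^{j+1}(p_xg)=(j+1)\langle\eta,x\rangle D^jg\ne0$.  So dividing by a linear form that is not constant
  along $\eta$ lowers the order of nilpotency, which is how exponents drop under deletion.
\<close>

lemma dir_deriv_pow_cancel_lin_form:
  assumes zero: "(dir_deriv \<eta> ^^ Suc k) (lin_form x * g) = 0" and nz: "\<eta> \<bullet> x \<noteq> 0"
  shows "(dir_deriv \<eta> ^^ k) g = 0"
proof (rule ccontr)
  assume neq: "(dir_deriv \<eta> ^^ k) g \<noteq> 0"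
  \<comment> \<open>the last nonvanishing derivative is the one before the first vanishing one, number \<open>j\<close>\<close>
  obtain N where N: "(dir_deriv \<eta> ^^ N) g = 0" using dir_deriv_nilpotent by blast
  define j where "j = (LEAST j. (dir_deriv \<eta> ^^ j) g = 0)"
  have j: "(dir_deriv \<eta> ^^ j) g = 0" unfolding j_def using N by (rule LeastI[where P = "\<lambda>j. (dir_deriv \<eta> ^^ j) g = 0"])
  have kj: "k < j" using neq dir_deriv_pow_mono[OF j] by (meson not_le)
  then obtain i where i: "j = Suc i" by (cases j) auto
  have "(dir_deriv \<eta> ^^ i) g \<noteq> 0" using not_less_Least[of i "\<lambda>j. (dir_deriv \<eta> ^^ j) g = 0"] i j_def by auto
  moreover have "(dir_deriv \<eta> ^^ Suc i) (lin_form x * g) = 0"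
    using kj i by (intro dir_deriv_pow_mono[OF zero]) simp
  ultimately show False
    using j nz unfolding i dir_deriv_pow_lin_form_mult[where \<eta> = \<eta> and k = i]
    by (simp del: of_nat_Suc)
qed

lemma lin_form_mult_eq_0:
  assumes "lin_form x * g = 0" "x \<noteq> 0"
  shows "g = 0"
  using dir_deriv_pow_cancel_lin_form[where \<eta> = x and k = 0 and x = x and g = g] assms by simp

subsection \<open>The action of polynomials as differential operators\<close>

lemma partial_pow_add: "(partial i ^^ k) (p + q) = (partial i ^^ k) p + (partial i ^^ k) q"
  by (induction k) (simp_all add: partial_add)

lemma partial_pow_cscale: "(partial i ^^ k) (cscale c q) = cscale c ((partial i ^^ k) q)"
  by (induction k) (simp_all add: partial_cscale)

lemma partial_pow_commute: "(partial i ^^ k) ((partial j ^^ l) q) = (partial j ^^ l) ((partial i ^^ k) q)"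
proof -
  have 1: "partial i ((partial j ^^ n) q) = (partial j ^^ n) (partial i q)" for n q
  proof (induction n)
    case (Suc n)
    then show ?case using partial_commute[of i j] by simp
  qed simp
  show ?thesis by (induction k) (simp_all add: 1)
qed


text \<open>The fold over a set of variables, in the recursive form used by the inductions below.\<close>

definition monom_diff_on :: "'n set \<Rightarrow> ('n::finite \<Rightarrow>\<^sub>0 nat) \<Rightarrow> 'n cpoly \<Rightarrow> 'n cpoly" where
  "monom_diff_on A a q = Finite_Set.fold (\<lambda>i. partial i ^^ Poly_Mapping.lookup a i) q A"

lemma monom_diff_on_empty [simp]: "monom_diff_on {} a q = q"
  by (simp add: monom_diff_on_def)

lemma monom_diff_on_insert:
  "i \<notin> A \<Longrightarrow> monom_diff_on (insert i A) a q = (partial i ^^ Poly_Mapping.lookup a i) (monom_diff_on A a q)"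
  unfolding monom_diff_on_def
  by (rule comp_fun_commute_on.fold_insert[OF comp_fun_commute_partial_power[unfolded comp_fun_commute_def']]) simp_all

lemma monom_diff_eq: "monom_diff a q = monom_diff_on UNIV a q"
  by (simp add: monom_diff_def monom_diff_on_def)

lemma monom_diff_add: "monom_diff a (p + q) = monom_diff a p + monom_diff a q"
proof -
  have "monom_diff_on A a (p + q) = monom_diff_on A a p + monom_diff_on A a q" for A
    using finite[of A] by (induction A rule: finite_induct) (simp_all add: monom_diff_on_insert partial_pow_add)
  then show ?thesis by (simp add: monom_diff_eq)
qed

lemma monom_diff_cscale: "monom_diff a (cscale c q) = cscale c (monom_diff a q)"
proof -
  have "monom_diff_on A a (cscale c q) = cscale c (monom_diff_on A a q)" for A
    using finite[of A] by (induction A rule: finite_induct) (simp_all add: monom_diff_on_insert partial_pow_cscale)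
  then show ?thesis by (simp add: monom_diff_eq)
qed

lemma monom_diff_compose: "monom_diff (a + b) q = monom_diff a (monom_diff b q)"
proof -
  have comm: "(partial i ^^ k) (monom_diff_on A a q) = monom_diff_on A a ((partial i ^^ k) q)" for i k A q
    using finite[of A]
  proof (induction A rule: finite_induct)
    case (insert j A)
    then show ?case
      using partial_pow_commute[of k i _ j] by (simp add: monom_diff_on_insert)
  qed simp
  have "monom_diff_on A (a + b) q = monom_diff_on A a (monom_diff_on A b q)" for A
    using finite[of A]
    by (induction A rule: finite_induct) (simp_all add: monom_diff_on_insert lookup_add funpow_add comm)
  then show ?thesis by (simp add: monom_diff_eq)
qed

lemma monom_diff_0 [simp]: "monom_diff 0 q = q"
proof -
  have "monom_diff_on A 0 q = q" for A
    using finite[of A] by (induction A rule: finite_induct) (simp_all add: monom_diff_on_insert)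
  then show ?thesis by (simp add: monom_diff_eq)
qed

lemma monom_diff_single: "monom_diff (Poly_Mapping.single i 1) q = partial i q"
proof -
  have "monom_diff_on A (Poly_Mapping.single i 1) q = q" if "i \<notin> A" for A
    using finite[of A] that
    by (induction A rule: finite_induct) (auto simp: monom_diff_on_insert lookup_single when_def)
  then have "monom_diff_on (insert i (- {i})) (Poly_Mapping.single i 1) q = partial i q"
    by (simp add: monom_diff_on_insert)
  moreover have "insert i (- {i}) = UNIV" by blast
  ultimately show ?thesis by (simp add: monom_diff_eq)
qed

lemma diff_op_single: "diff_op (Poly_Mapping.single a c) q = cscale c (monom_diff a q)"
  by (cases "c = 0") (simp_all add: diff_op_def)

lemma diff_op_superset:
  assumes "finite A" "Poly_Mapping.keys p \<subseteq> A"
  shows "diff_op p q = (\<Sum>a\<in>A. cscale (Poly_Mapping.lookup p a) (monom_diff a q))"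
  unfolding diff_op_def using assms
  by (intro sum.mono_neutral_left) (auto simp: in_keys_iff)

lemma diff_op_add_left: "diff_op (p + p') q = diff_op p q + diff_op p' q"
proof -
  let ?A = "Poly_Mapping.keys p \<union> Poly_Mapping.keys p'"
  have "Poly_Mapping.keys (p + p') \<subseteq> ?A" by (rule keys_add)
  then show ?thesis
    by (subst (1 2 3) diff_op_superset[of ?A])
      (auto simp: lookup_add cpoly.scale_left_distrib sum.distrib)
qed

lemma diff_op_0_left [simp]: "diff_op 0 q = 0"
  by (simp add: diff_op_def)

lemma diff_op_add_right: "diff_op p (q + q') = diff_op p q + diff_op p q'"
  by (simp add: diff_op_def monom_diff_add cpoly.scale_right_distrib sum.distrib)

lemma diff_op_cscale_right: "diff_op p (cscale c q) = cscale c (diff_op p q)"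
  by (simp add: diff_op_def monom_diff_cscale cpoly.scale_sum_right mult.commute)

lemma diff_op_0_right [simp]: "diff_op p 0 = 0"
  using diff_op_cscale_right[of p 0 0] by simp

lemma diff_op_mult: "diff_op (p * p') q = diff_op p (diff_op p' q)"
proof (induction p rule: monomial_induct)
  case (monomial a c)
  show ?case
  proof (induction p' rule: monomial_induct)
    case (monomial b d)
    show ?case
      by (simp add: mult_single diff_op_single monom_diff_compose monom_diff_cscale)
  next
    case (add p p')
    then show ?case by (simp add: distrib_left diff_op_add_left diff_op_add_right)
  qed
next
  case (add p1 p2)
  then show ?case by (simp add: distrib_right diff_op_add_left)
qed

lemma diff_op_sum_left: "diff_op (sum f A) q = (\<Sum>a\<in>A. diff_op (f a) q)"
  by (induction A rule: infinite_finite_induct) (simp_all add: diff_op_add_left)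

lemma diff_op_lin_form: "diff_op (lin_form \<eta>) q = dir_deriv \<eta> q"
proof -
  have "diff_op (cscale c (var i)) q = cscale c (partial i q)" for c and i :: 'a
    by (simp add: cscale_def diff_op_mult diff_op_single var_def monom_diff_single[unfolded One_nat_def])
  then show ?thesis
    by (simp add: lin_form_def diff_op_sum_left dir_deriv_def)
qed

lemma diff_op_lin_form_pow: "diff_op (lin_form \<eta> ^ k) q = (dir_deriv \<eta> ^^ k) q"
proof (induction k)
  case 0
  show ?case using diff_op_single[of 0 1 q] by simp
qed (simp add: diff_op_mult diff_op_lin_form)

lemma ideal_ker_generated_ideal:
  "q \<in> ideal_ker (generated_ideal G) \<longleftrightarrow> (\<forall>g\<in>G. diff_op g q = 0)"
proof
  assume "q \<in> ideal_ker (generated_ideal G)"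
  then show "\<forall>g\<in>G. diff_op g q = 0"
    by (auto simp: ideal_ker_def generated_ideal_def cpoly_ideal.span_base)
next
  assume G: "\<forall>g\<in>G. diff_op g q = 0"
  have "diff_op p q = 0" if "p \<in> cpoly_ideal.span G" for p
    using that
  proof (induction rule: cpoly_ideal.span_induct_alt)
    case (step c x y)
    then show ?case using G by (simp add: diff_op_add_left diff_op_mult)
  qed simp
  then show "q \<in> ideal_ker (generated_ideal G)"
    by (simp add: ideal_ker_def generated_ideal_def)
qed

subsection \<open>Substitution and restriction to a hyperplane\<close>

definition poly_subst :: "('n::finite \<Rightarrow> 'n cpoly) \<Rightarrow> 'n cpoly \<Rightarrow> 'n cpoly" where
  "poly_subst s q = (\<Sum>a\<in>Poly_Mapping.keys q.
     cscale (Poly_Mapping.lookup q a) (\<Prod>i\<in>UNIV. s i ^ Poly_Mapping.lookup a i))"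

lemma poly_subst_superset:
  assumes "finite A" "Poly_Mapping.keys q \<subseteq> A"
  shows "poly_subst s q = (\<Sum>a\<in>A.
     cscale (Poly_Mapping.lookup q a) (\<Prod>i\<in>UNIV. s i ^ Poly_Mapping.lookup a i))"
  unfolding poly_subst_def using assms
  by (intro sum.mono_neutral_left) (auto simp: in_keys_iff)

lemma poly_subst_single:
  "poly_subst s (Poly_Mapping.single a c) = cscale c (\<Prod>i\<in>UNIV. s i ^ Poly_Mapping.lookup a i)"
  by (cases "c = 0") (simp_all add: poly_subst_def)

lemma poly_subst_add: "poly_subst s (p + q) = poly_subst s p + poly_subst s q"
proof -
  let ?A = "Poly_Mapping.keys p \<union> Poly_Mapping.keys q"
  have "Poly_Mapping.keys (p + q) \<subseteq> ?A" by (rule keys_add)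
  then show ?thesis
    by (subst (1 2 3) poly_subst_superset[of ?A])
      (auto simp: lookup_add cpoly.scale_left_distrib sum.distrib)
qed

lemma poly_subst_const [simp]: "poly_subst s (Poly_Mapping.single 0 c) = Poly_Mapping.single 0 c"
  by (simp add: poly_subst_single cscale_def)

lemma poly_subst_0 [simp]: "poly_subst s 0 = 0"
  by (simp add: poly_subst_def)

lemma poly_subst_1 [simp]: "poly_subst s 1 = 1"
  using poly_subst_const[of s 1] by simp

lemma poly_subst_mult: "poly_subst s (p * q) = poly_subst s p * poly_subst s q"
proof (induction p rule: monomial_induct)
  case (monomial a c)
  show ?case
  proof (induction q rule: monomial_induct)
    case (monomial b d)
    show ?case
      by (simp add: mult_single poly_subst_single lookup_add power_add prod.distrib
          cscale_mult_left cscale_mult_right)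
  next
    case (add p q)
    then show ?case by (simp add: distrib_left poly_subst_add)
  qed
next
  case (add p1 p2)
  then show ?case by (simp add: distrib_right poly_subst_add)
qed

lemma poly_subst_cscale: "poly_subst s (cscale c q) = cscale c (poly_subst s q)"
  by (simp add: cscale_def poly_subst_mult)

lemma linear_poly_subst: "Vector_Spaces.linear cscale cscale (poly_subst s)"
  by unfold_locales (simp_all add: poly_subst_add poly_subst_cscale)

lemma poly_subst_sum: "poly_subst s (sum f A) = (\<Sum>a\<in>A. poly_subst s (f a))"
  by (induction A rule: infinite_finite_induct) (simp_all add: poly_subst_add)

lemma poly_subst_prod: "poly_subst s (prod f A) = (\<Prod>a\<in>A. poly_subst s (f a))"
  by (induction A rule: infinite_finite_induct) (simp_all add: poly_subst_mult)

lemma poly_subst_var: "poly_subst s (var i) = s i"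
proof -
  have "(\<Prod>j\<in>UNIV. s j ^ Poly_Mapping.lookup (Poly_Mapping.single i 1) j) = (\<Prod>j\<in>UNIV. if j = i then s j else 1)"
    by (intro prod.cong refl) (auto simp: lookup_single when_def)
  then show ?thesis by (simp add: var_def poly_subst_single)
qed

definition perp_proj :: "'a::real_inner \<Rightarrow> 'a \<Rightarrow> 'a" where
  "perp_proj x y = y - ((x \<bullet> y) / (x \<bullet> x)) *\<^sub>R x"

lemma perp_proj_add: "perp_proj x (y + z) = perp_proj x y + perp_proj x z"
  by (simp add: perp_proj_def inner_add_right add_divide_distrib scaleR_left_distrib)

lemma perp_proj_scaleR: "perp_proj x (c *\<^sub>R y) = c *\<^sub>R perp_proj x y"
  by (simp add: perp_proj_def scaleR_diff_right)

lemma linear_perp_proj: "linear (perp_proj x)"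
  by (rule linearI) (simp_all add: perp_proj_add perp_proj_scaleR)

lemma perp_proj_self [simp]: "perp_proj x x = 0"
  by (cases "x = 0") (simp_all add: perp_proj_def)

lemma inner_perp_proj_self: "x \<bullet> perp_proj x y = 0"
  by (cases "x = 0") (simp_all add: perp_proj_def inner_diff_right)

lemma inner_perp_proj: "\<eta> \<bullet> perp_proj x y = perp_proj x \<eta> \<bullet> y"
  by (simp add: perp_proj_def inner_diff_right inner_diff_left inner_commute)

text \<open>Composition with the orthogonal projection onto the hyperplane orthogonal to \<open>x\<close>.\<close>

definition restrict_perp :: "real ^ 'n::finite \<Rightarrow> 'n cpoly \<Rightarrow> 'n cpoly" where
  "restrict_perp x = poly_subst (\<lambda>i. lin_form (perp_proj x (axis i 1)))"

lemma linear_restrict_perp: "Vector_Spaces.linear cscale cscale (restrict_perp x)"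
  unfolding restrict_perp_def by (rule linear_poly_subst)

lemma restrict_perp_mult: "restrict_perp x (p * q) = restrict_perp x p * restrict_perp x q"
  unfolding restrict_perp_def by (rule poly_subst_mult)

lemma restrict_perp_lin_form: "restrict_perp x (lin_form y) = lin_form (perp_proj x y)"
proof -
  have "restrict_perp x (lin_form y) = lin_form (\<Sum>i\<in>UNIV. (y $ i) *\<^sub>R perp_proj x (axis i 1))"
    unfolding restrict_perp_def lin_form_sum lin_form_scaleR
    by (simp add: lin_form_def[of y] poly_subst_sum poly_subst_cscale poly_subst_var)
  also have "(\<Sum>i\<in>UNIV. (y $ i) *\<^sub>R perp_proj x (axis i 1)) = perp_proj x (\<Sum>i\<in>UNIV. (y $ i) *\<^sub>R axis i 1)"
    by (simp add: linear_sum[OF linear_perp_proj] perp_proj_scaleR)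
  also have "(\<Sum>i\<in>UNIV. (y $ i) *\<^sub>R axis i 1) = y"
    using basis_expansion[of y] by (simp add: scalar_mult_eq_scaleR)
  finally show ?thesis .
qed

lemma restrict_perp_prod_form: "restrict_perp x (prod_form v Y) = prod_form (perp_proj x \<circ> v) Y"
  unfolding prod_form_def by (simp add: restrict_perp_lin_form poly_subst_prod flip: restrict_perp_def)
    (simp add: restrict_perp_def poly_subst_prod restrict_perp_lin_form[unfolded restrict_perp_def])

text \<open>
  Orthogonal projection is self-adjoint, so differentiating a restriction along $\eta$ amounts to
  differentiating along the projection of $\eta$ first.
\<close>

lemma dir_deriv_restrict_perp: "dir_deriv \<eta> (restrict_perp x q) = restrict_perp x (dir_deriv (perp_proj x \<eta>) q)"
proof (induction q rule: cpoly_induct)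
  case (const c)
  then show ?case by (simp add: restrict_perp_def)
next
  case (var i)
  have "restrict_perp x (var i) = lin_form (perp_proj x (axis i 1))"
    by (simp add: restrict_perp_def poly_subst_var)
  then show ?case
    by (simp add: dir_deriv_lin_form dir_deriv_var inner_perp_proj)
      (simp add: restrict_perp_def inner_axis)
next
  case (add p q)
  then show ?case by (simp add: dir_deriv_add restrict_perp_def poly_subst_add)
next
  case (mult p q)
  then show ?case
    by (simp add: dir_deriv_mult restrict_perp_mult)
      (simp add: restrict_perp_def poly_subst_add poly_subst_mult)
qed

lemma dir_deriv_pow_restrict_perp:
  "(dir_deriv \<eta> ^^ k) (restrict_perp x q) = restrict_perp x ((dir_deriv (perp_proj x \<eta>) ^^ k) q)"
  by (induction k) (simp_all add: dir_deriv_restrict_perp)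

text \<open>
  Modulo $p_x$ a variable agrees with its restriction, hence so does every polynomial.
\<close>

lemma restrict_perp_eq_0D:
  assumes "restrict_perp x q = 0"
  obtains g where "q = lin_form x * g"
proof -
  have "\<exists>g. q - restrict_perp x q = lin_form x * g"
  proof (induction q rule: cpoly_induct)
    case (const c)
    have "Poly_Mapping.single 0 c - restrict_perp x (Poly_Mapping.single 0 c) = lin_form x * 0"
      by (simp add: restrict_perp_def)
    then show ?case by blast
  next
    case (var i)
    have "var i - restrict_perp x (var i) = lin_form (axis i 1 - perp_proj x (axis i 1))"
      by (simp add: restrict_perp_lin_form lin_form_diff flip: lin_form_axis)
    also have "\<dots> = lin_form x * Poly_Mapping.single 0 (complex_of_real ((x \<bullet> axis i 1) / (x \<bullet> x)))"
      by (simp add: perp_proj_def lin_form_scaleR cscale_def mult.commute)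
    finally show ?case by blast
  next
    case (add p q)
    then obtain g h where "p - restrict_perp x p = lin_form x * g" "q - restrict_perp x q = lin_form x * h"
      by blast
    then have "p + q - (restrict_perp x p + restrict_perp x q) = lin_form x * (g + h)"
      by (simp only: distrib_left add_diff_add)
    then have "p + q - restrict_perp x (p + q) = lin_form x * (g + h)"
      by (simp only: restrict_perp_def poly_subst_add)
    then show ?case by blast
  next
    case (mult p q)
    then obtain g h where gh: "p - restrict_perp x p = lin_form x * g" "q - restrict_perp x q = lin_form x * h"
      by blast
    have "p * q - restrict_perp x (p * q)
        = (p - restrict_perp x p) * q + restrict_perp x p * (q - restrict_perp x q)"
      by (simp add: restrict_perp_mult algebra_simps)
    also have "\<dots> = lin_form x * (g * q + restrict_perp x p * h)"
      by (simp add: gh algebra_simps)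
    finally show ?case by blast
  qed
  with assms show ?thesis using that by auto
qed

section \<open>Families of vectors\<close>

definition lin_indep :: "('e \<Rightarrow> 'a::real_vector) \<Rightarrow> 'e set \<Rightarrow> bool" where
  "lin_indep v B \<longleftrightarrow> (\<forall>b\<in>B. v b \<notin> span (v ` (B - {b})))"

text \<open>
  The elementwise form of independence of a family passes well through insertion and contraction.
\<close>

lemma lin_indep_iff: "lin_indep v B \<longleftrightarrow> inj_on v B \<and> independent (v ` B)"
proof
  assume B: "lin_indep v B"
  have inj: "inj_on v B"
  proof (rule inj_onI, rule ccontr)
    fix b c assume bc: "b \<in> B" "c \<in> B" "v b = v c" "b \<noteq> c"
    then have "v b \<in> v ` (B - {b})" by (auto intro: image_eqI[of _ _ c])
    then have "v b \<in> span (v ` (B - {b}))" by (rule span_base)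
    with bc(1) B show False by (simp add: lin_indep_def)
  qed
  have "v ` B - {v b} = v ` (B - {b})" if "b \<in> B" for b
    using inj_on_image_set_diff[OF inj, of B "{b}"] that by auto
  with B inj show "inj_on v B \<and> independent (v ` B)"
    by (auto simp: lin_indep_def dependent_def)
next
  assume B: "inj_on v B \<and> independent (v ` B)"
  then have "v ` B - {v b} = v ` (B - {b})" if "b \<in> B" for b
    using inj_on_image_set_diff[of v B B "{b}"] that by auto
  with B show "lin_indep v B"
    by (auto simp: lin_indep_def dependent_def)
qed

definition bases :: "('e \<Rightarrow> 'a::real_vector) \<Rightarrow> 'e set \<Rightarrow> 'e set set" where
  "bases v E = {B. B \<subseteq> E \<and> lin_indep v B \<and> v ` E \<subseteq> span (v ` B)}"

lemma finite_bases: "finite E \<Longrightarrow> finite (bases v E)"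
  by (rule finite_subset[of _ "Pow E"]) (auto simp: bases_def)

text \<open>
  Projecting along \<open>x\<close> is a model of the quotient by the line of \<open>x\<close>; all facts about the contraction
  $X/x$ come from here.
\<close>

lemma perp_proj_in_span_iff:
  "perp_proj x z \<in> span (perp_proj x ` S) \<longleftrightarrow> z \<in> span (insert x S)"
proof
  assume "perp_proj x z \<in> span (perp_proj x ` S)"
  then obtain w where w: "w \<in> span S" "perp_proj x z = perp_proj x w"
    unfolding linear_span_image[OF linear_perp_proj] by blast
  then have "z - ((x \<bullet> z) / (x \<bullet> x) - (x \<bullet> w) / (x \<bullet> x)) *\<^sub>R x = w"
    by (simp add: perp_proj_def algebra_simps)
  with w(1) show "z \<in> span (insert x S)"
    unfolding span_breakdown_eq by metis
next
  assume "z \<in> span (insert x S)"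
  then have "perp_proj x z \<in> perp_proj x ` span (insert x S)" by blast
  also have "\<dots> = span (insert 0 (perp_proj x ` S))"
    by (simp flip: linear_span_image[OF linear_perp_proj])
  finally show "perp_proj x z \<in> span (perp_proj x ` S)" by simp
qed

text \<open>
  For $b\in B$ both sides say the same by \<open>perp_proj_in_span_iff\<close>.  The extra condition
  $x\notin\mathrm{span}\,B$ on the left follows from the right: otherwise the exchange property would
  remove the elements of $B$ one by one from a representation of $x$, leaving $x=0$.
\<close>

lemma lin_indep_insert_iff_contract:
  assumes "finite B" "x \<notin> B" "v x \<noteq> 0"
  shows "lin_indep v (insert x B) \<longleftrightarrow> lin_indep (perp_proj (v x) \<circ> v) B"
proof -
  have contract: "(perp_proj (v x) \<circ> v) b \<in> span ((perp_proj (v x) \<circ> v) ` (B - {b}))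
      \<longleftrightarrow> v b \<in> span (v ` (insert x B - {b}))" if "b \<in> B" for b
  proof -
    have "insert x B - {b} = insert x (B - {b})" using that assms(2) by auto
    then show ?thesis
      using perp_proj_in_span_iff[of "v x" "v b" "v ` (B - {b})"] by (simp add: image_image)
  qed
  have "v x \<notin> span (v ` B)" if ind: "lin_indep (perp_proj (v x) \<circ> v) B"
  proof
    assume x: "v x \<in> span (v ` B)"
    have "v x \<in> span (v ` (B - F))" if "finite F" "F \<subseteq> B" for F
      using that
    proof (induction rule: finite_induct)
      case (insert b F)
      let ?S = "v ` (B - insert b F)"
      have "B - F = insert b (B - insert b F)" using insert.prems insert.hyps by auto
      then have "v x \<in> span (insert (v b) ?S)"
        using insert by (metis image_insert insert_subset)
      show ?case
      proof (rule ccontr)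
        assume "v x \<notin> span ?S"
        with \<open>v x \<in> span (insert (v b) ?S)\<close> have "v b \<in> span (insert (v x) ?S)"
          by (rule in_span_insert)
        also have "\<dots> \<subseteq> span (v ` (insert x B - {b}))"
          using insert.prems assms(2) by (intro span_mono) auto
        finally show False
          using ind contract[of b] insert.prems unfolding lin_indep_def by blast
      qed
    qed (use x in simp)
    from this[OF assms(1)] show False using assms(3) by simp
  qed
  moreover have "insert x B - {x} = B" using assms(2) by auto
  ultimately show ?thesis
    using contract unfolding lin_indep_def by auto
qed

lemma spanning_insert_iff_contract:
  assumes "x \<in> E"
  shows "v ` E \<subseteq> span (v ` insert x B)
    \<longleftrightarrow> (perp_proj (v x) \<circ> v) ` (E - {x}) \<subseteq> span ((perp_proj (v x) \<circ> v) ` B)"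
proof -
  have "v x \<in> span (v ` insert x B)" by (auto intro: span_base)
  then have "v ` E \<subseteq> span (v ` insert x B) \<longleftrightarrow> (\<forall>e\<in>E - {x}. v e \<in> span (insert (v x) (v ` B)))"
    using assms by (auto simp: image_subset_iff)
  then show ?thesis
    using perp_proj_in_span_iff[of "v x" _ "v ` B"] by (simp add: image_image image_subset_iff)
qed

lemma bases_insert_iff_contract:
  assumes "finite E" "x \<in> E" "B \<subseteq> E - {x}" "v x \<noteq> 0"
  shows "insert x B \<in> bases v E \<longleftrightarrow> B \<in> bases (perp_proj (v x) \<circ> v) (E - {x})"
proof -
  have "finite B" "x \<notin> B" using assms finite_subset by auto
  then show ?thesis
    using assms lin_indep_insert_iff_contract[of B x v] spanning_insert_iff_contract[of x E v B]
    unfolding bases_def by auto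
qed

lemma bases_delete_subset:
  assumes "v ` E \<subseteq> span (v ` (E - {x}))"
  shows "bases v (E - {x}) \<subseteq> bases v E"
proof
  fix B assume B: "B \<in> bases v (E - {x})"
  then have "span (v ` (E - {x})) \<subseteq> span (v ` B)"
    by (simp add: bases_def span_minimal)
  with assms B show "B \<in> bases v E" by (auto simp: bases_def)
qed

lemma exists_normal:
  fixes y :: "'a::euclidean_space"
  assumes "y \<notin> span S"
  obtains \<eta> where "\<And>s. s \<in> S \<Longrightarrow> \<eta> \<bullet> s = 0" "\<eta> \<bullet> y \<noteq> 0"
proof -
  obtain w z where wz: "w \<in> span S" "\<And>u. u \<in> span S \<Longrightarrow> orthogonal z u" "y = w + z"
    using orthogonal_subspace_decomp_exists[of S y] by metis
  have "z \<bullet> w = 0" using wz(1,2) by (simp add: orthogonal_def)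
  moreover have "z \<noteq> 0" using assms wz(1,3) by auto
  ultimately have "z \<bullet> y \<noteq> 0" by (simp add: wz(3) inner_add_right)
  then show ?thesis
    using that[of z] wz(2) by (auto simp: orthogonal_def span_base)
qed

lemma inner_eq_0_on_span:
  assumes "\<And>s. s \<in> S \<Longrightarrow> \<eta> \<bullet> s = 0" "y \<in> span S"
  shows "\<eta> \<bullet> y = 0"
  using assms(2) by (induction rule: span_induct_alt) (simp_all add: inner_add_right assms(1))

section \<open>Internal bases and the kernel of the ideal, relative to the span\<close>

definition null_labels :: "('e \<Rightarrow> 'a::real_inner) \<Rightarrow> 'e set \<Rightarrow> 'a \<Rightarrow> 'e set" where
  "null_labels v E \<eta> = {x\<in>E. \<eta> \<bullet> v x = 0}"

definition conull_labels :: "('e \<Rightarrow> 'a::real_inner) \<Rightarrow> 'e set \<Rightarrow> 'a \<Rightarrow> 'e set" where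
  "conull_labels v E \<eta> = {x\<in>E. \<eta> \<bullet> v x \<noteq> 0}"

text \<open>
  The hyperplane orthogonal to \<open>\<eta>\<close> is spanned, within the span of the family, by members of the
  family.  Any further element completes it to the full span; asking for one such element suffices,
  and makes the notion transfer directly to deletions and contractions.
\<close>

definition facet_normal :: "('e \<Rightarrow> 'a::real_inner) \<Rightarrow> 'e set \<Rightarrow> 'a \<Rightarrow> bool" where
  "facet_normal v E \<eta> \<longleftrightarrow> (\<exists>x\<in>conull_labels v E \<eta>. v ` E \<subseteq> span (v ` insert x (null_labels v E \<eta>)))"

lemma facet_normal_delete:
  assumes span: "v ` E \<subseteq> span (v ` (E - {x}))" and \<eta>: "facet_normal v (E - {x}) \<eta>"
  shows "facet_normal v E \<eta>"
proof -
  obtain y where y: "y \<in> conull_labels v (E - {x}) \<eta>"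
    "v ` (E - {x}) \<subseteq> span (v ` insert y (null_labels v (E - {x}) \<eta>))"
    using \<eta> unfolding facet_normal_def by blast
  have "v ` E \<subseteq> span (v ` (E - {x}))" by (rule span)
  also have "\<dots> \<subseteq> span (v ` insert y (null_labels v (E - {x}) \<eta>))"
    using y(2) by (rule span_minimal) simp
  also have "\<dots> \<subseteq> span (v ` insert y (null_labels v E \<eta>))"
    by (intro span_mono image_mono) (auto simp: null_labels_def)
  finally show ?thesis
    unfolding facet_normal_def using y(1) by (intro bexI[of _ y]) (auto simp: conull_labels_def)
qed

text \<open>
  The kernel of $\mathcal I_-(X,I)$ for a family that need not span.  The first condition says that
  the polynomial comes from the symmetric algebra of the span.  Quantification over all normals
  replaces the choice of one normal for each facet.
\<close>

definition kernel_space :: "('e \<Rightarrow> real ^ 'n::finite) \<Rightarrow> 'e set \<Rightarrow> 'e set \<Rightarrow> 'n cpoly set" where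
  "kernel_space v E I = {q.
     (\<forall>\<eta>. (\<forall>x\<in>E. \<eta> \<bullet> v x = 0) \<longrightarrow> dir_deriv \<eta> q = 0) \<and>
     (\<forall>\<eta>. facet_normal v E \<eta> \<longrightarrow> (dir_deriv \<eta> ^^ card (conull_labels v E \<eta>)) q = 0 \<and>
        ((\<exists>x\<in>I. \<eta> \<bullet> v x \<noteq> 0) \<longrightarrow> (dir_deriv \<eta> ^^ (card (conull_labels v E \<eta>) - 1)) q = 0))}"

text \<open>
  Internal activity without the elements outside \<open>I\<close>: these precede \<open>I\<close>, so they never compete with
  \<open>b\<close> for being maximal in the complement of the hyperplane.
\<close>

definition active :: "('e \<Rightarrow> 'a::real_vector) \<Rightarrow> ('e \<times> 'e) set \<Rightarrow> 'e set \<Rightarrow> 'e set \<Rightarrow> 'e \<Rightarrow> bool" where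
  "active v r I B b \<longleftrightarrow> b \<in> I \<and> (\<forall>y\<in>I. (b, y) \<in> r \<longrightarrow> v y \<in> span (v ` (B - {b})))"

definition inactive_bases :: "('e \<Rightarrow> 'a::real_vector) \<Rightarrow> 'e set \<Rightarrow> ('e \<times> 'e) set \<Rightarrow> 'e set \<Rightarrow> 'e set set" where
  "inactive_bases v E r I = {B \<in> bases v E. \<forall>b\<in>B. \<not> active v r I B b}"

lemma finite_inactive_bases: "finite E \<Longrightarrow> finite (inactive_bases v E r I)"
  using finite_bases[of E v] by (simp add: inactive_bases_def)

lemma subspace_kernel_space:
  fixes v :: "'e \<Rightarrow> real ^ 'b::finite"
  shows "cpoly.subspace (kernel_space v E I)"
proof (rule cpoly.subspaceI)
  show "0 \<in> kernel_space v E I" by (simp add: kernel_space_def)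
  show "p + q \<in> kernel_space v E I" if "p \<in> kernel_space v E I" "q \<in> kernel_space v E I" for p q
    using that by (simp add: kernel_space_def dir_deriv_add dir_deriv_pow_add)
  have "(dir_deriv \<eta> ^^ k) (cscale c q) = cscale c ((dir_deriv \<eta> ^^ k) q)" for \<eta> k c and q :: "'b::finite cpoly"
    by (induction k) (simp_all add: dir_deriv_cscale)
  then show "cscale c q \<in> kernel_space v E I" if "q \<in> kernel_space v E I" for c q
    using that by (simp add: kernel_space_def dir_deriv_cscale)
qed

lemma dir_deriv_pow_lin_form_mult_orthogonal:
  "\<eta> \<bullet> x = 0 \<Longrightarrow> (dir_deriv \<eta> ^^ k) (lin_form x * g) = lin_form x * (dir_deriv \<eta> ^^ k) g"
  by (induction k) (simp_all add: dir_deriv_mult dir_deriv_lin_form)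

text \<open>
  A facet of $X/x$ is a facet of $X$ through $x$, and the two have the same complement.  The order of
  vanishing is therefore unchanged.
\<close>

lemma restrict_perp_kernel_space:
  assumes x: "x \<in> E" "x \<notin> I" and q: "q \<in> kernel_space v E I"
  shows "restrict_perp (v x) q \<in> kernel_space (perp_proj (v x) \<circ> v) (E - {x}) I"
proof -
  let ?v' = "perp_proj (v x) \<circ> v"
  have orth: "perp_proj (v x) \<eta> \<bullet> v x = 0" for \<eta>
    using inner_perp_proj_self[of "v x" \<eta>] by (simp add: inner_commute)
  have inner: "\<eta> \<bullet> ?v' y = perp_proj (v x) \<eta> \<bullet> v y" for \<eta> y
    by (simp add: inner_perp_proj)
  have co: "conull_labels ?v' (E - {x}) \<eta> = conull_labels v E (perp_proj (v x) \<eta>)" for \<eta>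
    using orth[of \<eta>] by (auto simp: conull_labels_def inner_perp_proj)
  have null: "null_labels v E (perp_proj (v x) \<eta>) = insert x (null_labels ?v' (E - {x}) \<eta>)" for \<eta>
    using orth[of \<eta>] x(1) by (auto simp: null_labels_def inner_perp_proj)
  have facet: "facet_normal v E (perp_proj (v x) \<eta>)" if \<eta>: "facet_normal ?v' (E - {x}) \<eta>" for \<eta>
  proof -
    obtain y where y: "y \<in> conull_labels v E (perp_proj (v x) \<eta>)"
      "?v' ` (E - {x}) \<subseteq> span (?v' ` insert y (null_labels ?v' (E - {x}) \<eta>))"
      using \<eta> unfolding facet_normal_def co by blast
    from y(2) have "v ` E \<subseteq> span (v ` insert x (insert y (null_labels ?v' (E - {x}) \<eta>)))"
      by (simp only: spanning_insert_iff_contract[OF x(1)])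
    also have "insert x (insert y (null_labels ?v' (E - {x}) \<eta>)) = insert y (null_labels v E (perp_proj (v x) \<eta>))"
      by (auto simp: null)
    finally show ?thesis using y(1) unfolding facet_normal_def by blast
  qed
  have zero: "restrict_perp (v x) 0 = 0" by (simp add: restrict_perp_def)
  show ?thesis
    unfolding kernel_space_def
  proof (intro CollectI conjI allI impI)
    fix \<eta> assume "\<forall>y\<in>E - {x}. \<eta> \<bullet> ?v' y = 0"
    then have "\<forall>y\<in>E. perp_proj (v x) \<eta> \<bullet> v y = 0" using orth by (auto simp: inner_perp_proj)
    then have "dir_deriv (perp_proj (v x) \<eta>) q = 0" using q by (simp add: kernel_space_def)
    then show "dir_deriv \<eta> (restrict_perp (v x) q) = 0" by (simp add: dir_deriv_restrict_perp zero)
  next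
    fix \<eta> assume \<eta>: "facet_normal ?v' (E - {x}) \<eta>"
    then have "(dir_deriv (perp_proj (v x) \<eta>) ^^ card (conull_labels v E (perp_proj (v x) \<eta>))) q = 0"
      using q facet by (simp add: kernel_space_def)
    then show "(dir_deriv \<eta> ^^ card (conull_labels ?v' (E - {x}) \<eta>)) (restrict_perp (v x) q) = 0"
      by (simp only: dir_deriv_pow_restrict_perp zero co)
  next
    fix \<eta> assume \<eta>: "facet_normal ?v' (E - {x}) \<eta>" "\<exists>y\<in>I. \<eta> \<bullet> ?v' y \<noteq> 0"
    then have "(dir_deriv (perp_proj (v x) \<eta>) ^^ (card (conull_labels v E (perp_proj (v x) \<eta>)) - 1)) q = 0"
      using q facet unfolding inner by (simp add: kernel_space_def)
    then show "(dir_deriv \<eta> ^^ (card (conull_labels ?v' (E - {x}) \<eta>) - 1)) (restrict_perp (v x) q) = 0"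
      by (simp only: dir_deriv_pow_restrict_perp zero co)
  qed
qed

text \<open>
  A facet $F$ of $X\setminus x$ is a facet of $X$.  If $x\in F$, multiplication by $p_x$ commutes with
  $D_\eta$ and the exponents agree; otherwise the exponent for $X$ is larger by one, which
  \<open>dir_deriv_pow_cancel_lin_form\<close> makes up for.
\<close>

lemma kernel_space_lin_form_multD:
  assumes fin: "finite E" and x: "x \<in> E" "v x \<noteq> 0"
    and span: "v ` E \<subseteq> span (v ` (E - {x}))"
    and q: "lin_form (v x) * g \<in> kernel_space v E I"
  shows "g \<in> kernel_space v (E - {x}) I"
  unfolding kernel_space_def
proof (intro CollectI conjI allI impI)
  fix \<eta> assume \<eta>: "\<forall>y\<in>E - {x}. \<eta> \<bullet> v y = 0"
  have "v x \<in> span (v ` (E - {x}))" using span x(1) by blast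
  then have "\<eta> \<bullet> v x = 0" by (rule inner_eq_0_on_span[rotated]) (use \<eta> in auto)
  with \<eta> have "dir_deriv \<eta> (lin_form (v x) * g) = 0" using q by (auto simp: kernel_space_def)
  then show "dir_deriv \<eta> g = 0"
    using lin_form_mult_eq_0[OF _ x(2)] \<open>\<eta> \<bullet> v x = 0\<close>
    by (simp add: dir_deriv_mult dir_deriv_lin_form)
next
  have facet: "facet_normal v E \<eta> \<and> 0 < card (conull_labels v (E - {x}) \<eta>)"
    if \<eta>: "facet_normal v (E - {x}) \<eta>" for \<eta>
  proof -
    have "finite (conull_labels v (E - {x}) \<eta>)" using fin by (simp add: conull_labels_def)
    then show ?thesis
      using \<eta> facet_normal_delete[where v = v, OF span \<eta>] by (auto simp: facet_normal_def card_gt_0_iff)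
  qed
  have cancel: "(dir_deriv \<eta> ^^ (card (conull_labels v (E - {x}) \<eta>) - j)) g = 0"
    if \<eta>: "facet_normal v (E - {x}) \<eta>" and j: "j \<le> 1"
      and zero: "(dir_deriv \<eta> ^^ (card (conull_labels v E \<eta>) - j)) (lin_form (v x) * g) = 0" for \<eta> j
  proof (cases "\<eta> \<bullet> v x = 0")
    case True
    then have "conull_labels v E \<eta> = conull_labels v (E - {x}) \<eta>" by (auto simp: conull_labels_def)
    with zero show ?thesis
      using lin_form_mult_eq_0[OF _ x(2)] True by (simp add: dir_deriv_pow_lin_form_mult_orthogonal)
  next
    case False
    have "conull_labels v E \<eta> = insert x (conull_labels v (E - {x}) \<eta>)" using False x(1) by (auto simp: conull_labels_def)
    then have "card (conull_labels v E \<eta>) = Suc (card (conull_labels v (E - {x}) \<eta>))"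
      using fin by (simp add: conull_labels_def)
    \<comment> \<open>truncation does no harm for \<open>j = 1\<close>, because some element of the smaller family lies off the facet\<close>
    then have "card (conull_labels v E \<eta>) - j = Suc (card (conull_labels v (E - {x}) \<eta>) - j)"
      using facet[OF \<eta>] j by linarith
    then show ?thesis
      using zero False dir_deriv_pow_cancel_lin_form by metis
  qed
  show "(dir_deriv \<eta> ^^ card (conull_labels v (E - {x}) \<eta>)) g = 0" if "facet_normal v (E - {x}) \<eta>" for \<eta>
    using cancel[OF that, of 0] facet[OF that] q by (simp add: kernel_space_def)
  show "(dir_deriv \<eta> ^^ (card (conull_labels v (E - {x}) \<eta>) - 1)) g = 0"
    if "facet_normal v (E - {x}) \<eta>" "\<exists>y\<in>I. \<eta> \<bullet> v y \<noteq> 0" for \<eta>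
    using cancel[OF that(1), of 1] facet[OF that(1)] that(2) q by (simp add: kernel_space_def)
qed

lemma coloop_facet_normal:
  fixes v :: "'e \<Rightarrow> 'a::euclidean_space"
  assumes x: "x \<in> E" and coloop: "\<not> v ` E \<subseteq> span (v ` (E - {x}))"
  obtains \<eta> where "facet_normal v E \<eta>" "conull_labels v E \<eta> = {x}"
proof -
  have "v x \<notin> span (v ` (E - {x}))"
  proof
    assume "v x \<in> span (v ` (E - {x}))"
    then have "v y \<in> span (v ` (E - {x}))" if "y \<in> E" for y
      using that by (cases "y = x") (auto intro: span_base)
    with coloop show False by blast
  qed
  then obtain \<eta> where \<eta>: "\<And>s. s \<in> v ` (E - {x}) \<Longrightarrow> \<eta> \<bullet> s = 0" "\<eta> \<bullet> v x \<noteq> 0"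
    by (rule exists_normal) blast
  have co: "conull_labels v E \<eta> = {x}" and null: "null_labels v E \<eta> = E - {x}"
    using \<eta> x by (auto simp: conull_labels_def null_labels_def)
  have "v ` E \<subseteq> span (v ` insert x (E - {x}))" by (auto intro: span_base)
  then have "facet_normal v E \<eta>" by (simp add: facet_normal_def co null)
  with co that show thesis by blast
qed

text \<open>
  Here the elements other than $x$ span a facet of multiplicity one, so $D_\eta(p_xg)=0$ already
  forces $g=0$.
\<close>

lemma kernel_space_lin_form_mult_coloop:
  assumes x: "x \<in> E" and coloop: "\<not> v ` E \<subseteq> span (v ` (E - {x}))"
    and q: "lin_form (v x) * g \<in> kernel_space v E I"
  shows "g = 0"
proof -
  obtain \<eta> where \<eta>: "facet_normal v E \<eta>" and co: "conull_labels v E \<eta> = {x}"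
    by (rule coloop_facet_normal[OF x coloop])
  have nz: "\<eta> \<bullet> v x \<noteq> 0" using co by (auto simp: conull_labels_def)
  have "(dir_deriv \<eta> ^^ card (conull_labels v E \<eta>)) (lin_form (v x) * g) = 0"
    using q \<eta> unfolding kernel_space_def by blast
  then have "(dir_deriv \<eta> ^^ Suc 0) (lin_form (v x) * g) = 0" by (simp only: co card.empty card.insert) simp
  then show "g = 0" using dir_deriv_pow_cancel_lin_form[OF _ nz] by fastforce
qed

text \<open>
  Activity of $b\ne x$ only depends on spans of sets containing $x$, which the contraction preserves,
  and $x$ itself lies outside $I$.
\<close>

lemma inactive_bases_insert:
  assumes "finite E" "x \<in> E" "x \<notin> I" "v x \<noteq> 0"
    and B: "B \<in> inactive_bases (perp_proj (v x) \<circ> v) (E - {x}) r I"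
  shows "insert x B \<in> inactive_bases v E r I"
proof -
  have B': "B \<in> bases (perp_proj (v x) \<circ> v) (E - {x})" "B \<subseteq> E - {x}"
    using B by (auto simp: inactive_bases_def bases_def)
  have "\<not> active v r I (insert x B) b" if b: "b \<in> insert x B" for b
  proof
    assume act: "active v r I (insert x B) b"
    then have "b \<noteq> x" "b \<in> B" using assms(3) b by (auto simp: active_def)
    then have eq: "insert x B - {b} = insert x (B - {b})" by auto
    have "active (perp_proj (v x) \<circ> v) r I B b"
      using act perp_proj_in_span_iff[of "v x" _ "v ` (B - {b})"]
      by (simp add: active_def eq image_image)
    with B \<open>b \<in> B\<close> show False by (auto simp: inactive_bases_def)
  qed
  then show ?thesis
    using bases_insert_iff_contract[where v = v, OF assms(1,2) B'(2) assms(4)] B'(1)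
    by (simp add: inactive_bases_def)
qed

text \<open>
  The base case of the empty family: its kernel space consists of the constants.
\<close>

lemma constant_of_dir_deriv_0:
  fixes q :: "'n::finite cpoly"
  assumes "\<And>\<eta>. dir_deriv \<eta> q = 0"
  shows "q \<in> cpoly.span {1}"
proof -
  have partial: "partial i q = 0" for i
  proof -
    have "dir_deriv (axis i 1) q = (\<Sum>j\<in>UNIV. if j = i then partial j q else 0)"
      unfolding dir_deriv_def by (intro sum.cong refl) (auto simp: axis_def)
    then show ?thesis using assms[of "axis i 1"] by simp
  qed
  have "Poly_Mapping.lookup q a = 0" if a: "a \<noteq> 0" for a
  proof -
    obtain i where i: "Poly_Mapping.lookup a i \<noteq> 0"
      using a poly_mapping_eqI[of a 0] lookup_zero by metis
    have "a - Poly_Mapping.single i 1 + Poly_Mapping.single i 1 = a"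
      by (rule poly_mapping_eqI) (use i in \<open>auto simp: lookup_add lookup_minus lookup_single when_def\<close>)
    then show ?thesis
      using lookup_partial[of i q "a - Poly_Mapping.single i 1"] partial[of i]
      by (simp del: of_nat_Suc)
  qed
  then have "q = cscale (Poly_Mapping.lookup q 0) 1"
    by (intro poly_mapping_eqI) (auto simp: cscale_def lookup_single when_def)
  then show ?thesis by (metis cpoly.span_base cpoly.span_scale singletonI)
qed

lemma exists_least:
  assumes "finite I" "I \<noteq> {}" "trans r" "total_on I r"
  shows "\<exists>b\<in>I. \<forall>y\<in>I. y \<noteq> b \<longrightarrow> (b, y) \<in> r"
  using assms
proof (induction rule: finite_ne_induct)
  case (insert x F)
  then obtain b where b: "b \<in> F" "\<forall>y\<in>F. y \<noteq> b \<longrightarrow> (b, y) \<in> r"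
    by (metis subset_insertI total_on_subset)
  then have "b \<noteq> x" using insert.hyps by auto
  then consider "(b, x) \<in> r" | "(x, b) \<in> r"
    using insert.prems(2) b(1) by (auto simp: total_on_def)
  then show ?case
  proof cases
    case 1
    with b show ?thesis by (intro bexI[of _ b]) auto
  next
    case 2
    with b insert.prems(1) show ?thesis by (intro bexI[of _ x]) (auto dest: transD)
  qed
qed simp

lemma strict_linear_order_on_subset:
  "strict_linear_order_on E r \<Longrightarrow> F \<subseteq> E \<Longrightarrow> strict_linear_order_on F r"
  using total_on_subset by (auto simp: strict_linear_order_on_def)

lemma finite_strict_order_least:
  assumes "strict_linear_order_on E r" "I \<subseteq> E" "finite I" "I \<noteq> {}"
  obtains b where "b \<in> I" "\<And>y. y \<in> I \<Longrightarrow> y \<noteq> b \<Longrightarrow> (b, y) \<in> r" "\<And>y. y \<in> I \<Longrightarrow> (y, b) \<notin> r"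
proof -
  have r: "trans r" "irrefl r" "total_on I r"
    using assms(1,2) total_on_subset by (auto simp: strict_linear_order_on_def)
  then obtain b where b: "b \<in> I" "\<forall>y\<in>I. y \<noteq> b \<longrightarrow> (b, y) \<in> r"
    using exists_least[OF assms(3,4)] by blast
  have "(y, b) \<notin> r" if "y \<in> I" for y
    using that b r by (metis irrefl_def transD)
  with b that show ?thesis by blast
qed

section \<open>The upper bound by deletion and contraction\<close>

lemma kernel_space_antimono:
  "J \<subseteq> I \<Longrightarrow> kernel_space v E I \<subseteq> kernel_space v E J"
  unfolding kernel_space_def by blast

text \<open>
  If $c$ depends on larger elements of $I$, it is never active: a basis $B$ with $c$ active would have
  these elements, and with them $c$, in the span of $B\setminus c$.  This disposes of the dependent
  sets $I$ that contractions produce.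
\<close>

lemma inactive_bases_redundant:
  assumes c: "v c \<in> span (v ` {y\<in>I. (c, y) \<in> r})"
    and irrefl: "irrefl r"
  shows "inactive_bases v E r (I - {c}) \<subseteq> inactive_bases v E r I"
proof
  fix B assume B: "B \<in> inactive_bases v E r (I - {c})"
  have "\<not> active v r I B b" if b: "b \<in> B" for b
  proof
    assume act: "active v r I B b"
    show False
    proof (cases "b = c")
      case True
      have "v ` {y\<in>I. (c, y) \<in> r} \<subseteq> span (v ` (B - {c}))"
        using act True by (auto simp: active_def)
      then have "v c \<in> span (v ` (B - {c}))"
        using c span_minimal[OF _ subspace_span] by blast
      then show False
        using B b True by (auto simp: inactive_bases_def bases_def lin_indep_def)
    next
      case False
      then have "active v r (I - {c}) B b" using act by (auto simp: active_def)
      then show False using B b by (auto simp: inactive_bases_def)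
    qed
  qed
  then show "B \<in> inactive_bases v E r I" using B by (auto simp: inactive_bases_def)
qed

text \<open>
  Restriction maps $\mathcal K(X,I)$ into $\mathcal K(X/x,I)$, and what restricts to zero lies in
  $p_x\mathcal K(X\setminus x,I)$, or vanishes if $X\setminus x$ has smaller rank.  Inactive bases of
  $X/x$ become inactive bases of $X$ by adding $x$, while those of $X\setminus x$ are inactive bases of
  $X$ that avoid $x$.
\<close>

lemma kernel_space_dim_le_contract:
  fixes v :: "'e \<Rightarrow> real ^ 'n::finite"
  assumes fin: "finite E" and x: "x \<in> E" "x \<notin> I" "v x \<noteq> 0"
    and contract: "dim_at_most (kernel_space (perp_proj (v x) \<circ> v) (E - {x}) I)
        (card (inactive_bases (perp_proj (v x) \<circ> v) (E - {x}) r I))"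
    and delete: "dim_at_most (kernel_space v (E - {x}) I) (card (inactive_bases v (E - {x}) r I))"
  shows "dim_at_most (kernel_space v E I) (card (inactive_bases v E r I))"
proof -
  let ?v' = "perp_proj (v x) \<circ> v" and ?E' = "E - {x}"
  let ?K = "kernel_space v E I" and ?N = "inactive_bases v E r I" and ?C = "inactive_bases ?v' ?E' r I"
  have sub: "B \<subseteq> ?E'" if "B \<in> ?C" for B
    using that by (auto simp: inactive_bases_def bases_def)
  then have inj: "inj_on (insert x) ?C" by (intro inj_onI) blast
  have C: "insert x ` ?C \<subseteq> ?N"
    using inactive_bases_insert[where v = v, OF fin x(1,2,3)] by blast
  have finN: "finite ?N" by (rule finite_inactive_bases[OF fin])
  have im: "dim_at_most (restrict_perp (v x) ` ?K) (card ?C)"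
    by (rule dim_at_most_mono[OF contract]) (use restrict_perp_kernel_space[where v = v, OF x(1,2)] in auto)
  show ?thesis
  proof (cases "v ` E \<subseteq> span (v ` ?E')")
    case True
    let ?D = "inactive_bases v ?E' r I"
    have D: "?D \<subseteq> ?N" using bases_delete_subset[OF True] by (auto simp: inactive_bases_def)
    have disj: "insert x ` ?C \<inter> ?D = {}" by (auto simp: inactive_bases_def bases_def)
    have "card ?C + card ?D = card (insert x ` ?C \<union> ?D)"
      using finN D C disj by (simp add: card_Un_disjoint card_image[OF inj] finite_subset)
    also have "\<dots> \<le> card ?N" using C D finN by (intro card_mono) auto
    finally have le: "card ?C + card ?D \<le> card ?N" .
    have mult_linear: "Vector_Spaces.linear cscale cscale ((*) (lin_form (v x)))"
      by unfold_locales (simp_all add: distrib_left cscale_mult_right)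
    have "?K \<inter> {q. restrict_perp (v x) q = 0} \<subseteq> (*) (lin_form (v x)) ` kernel_space v ?E' I"
    proof
      fix q assume q: "q \<in> ?K \<inter> {q. restrict_perp (v x) q = 0}"
      then obtain g where g: "q = lin_form (v x) * g" using restrict_perp_eq_0D by blast
      then show "q \<in> (*) (lin_form (v x)) ` kernel_space v ?E' I"
        using kernel_space_lin_form_multD[where v = v, OF fin x(1,3) True] q by blast
    qed
    then have "dim_at_most (?K \<inter> {q. restrict_perp (v x) q = 0}) (card ?D)"
      by (rule dim_at_most_mono[OF dim_at_most_image[OF mult_linear delete]]) simp
    from dim_at_most_exact[OF linear_restrict_perp subspace_kernel_space im this]
    show ?thesis by (rule dim_at_most_mono[OF _ order.refl le])
  next
    case False
    have "?K \<inter> {q. restrict_perp (v x) q = 0} \<subseteq> {0}"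
    proof
      fix q assume q: "q \<in> ?K \<inter> {q. restrict_perp (v x) q = 0}"
      then obtain g where g: "q = lin_form (v x) * g" using restrict_perp_eq_0D by blast
      then have "g = 0"
        using kernel_space_lin_form_mult_coloop[where v = v, OF x(1) False] q by blast
      then show "q \<in> {0}" by (simp add: g)
    qed
    then have "dim_at_most (?K \<inter> {q. restrict_perp (v x) q = 0}) 0"
      unfolding dim_at_most_def by (intro exI[of _ "{}"]) auto
    from dim_at_most_exact[OF linear_restrict_perp subspace_kernel_space im this]
    have "dim_at_most ?K (card ?C)" by simp
    moreover have "card ?C \<le> card ?N"
      using card_mono[OF finN C] card_image[OF inj] by simp
    ultimately show ?thesis by (rule dim_at_most_mono[OF _ order.refl])
  qed
qed

text \<open>
  As long as some nonzero vector lies outside $I$, delete and contract it; zero vectors are just deleted.  If $I$ is the whole family and no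
  element depends on larger ones, the least element $b$ is a coloop: the remaining elements form a
  facet not containing $I$ of multiplicity one, so the identity $D_\eta^0$ annihilates the kernel space.
\<close>

lemma kernel_space_dim_le:
  fixes v :: "'e \<Rightarrow> real ^ 'n::finite"
  assumes "finite E" "I \<subseteq> E" "strict_linear_order_on I r"
  shows "dim_at_most (kernel_space v E I) (card (inactive_bases v E r I))"
  using assms
proof (induction "card E + card I" arbitrary: v E I rule: less_induct)
  case less
  note fin = \<open>finite E\<close> and sub = \<open>I \<subseteq> E\<close> and order = \<open>strict_linear_order_on I r\<close>
  have finI: "finite I" using fin sub by (rule rev_finite_subset)
  consider (redundant) c where "c \<in> I" "v c \<in> span (v ` {y\<in>I. (c, y) \<in> r})"
    | (loop) x where "x \<in> E" "x \<notin> I" "v x = 0"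
    | (contract) x where "x \<in> E" "x \<notin> I" "v x \<noteq> 0"
    | (all) "E = I" "\<And>c. c \<in> I \<Longrightarrow> v c \<notin> span (v ` {y\<in>I. (c, y) \<in> r})"
    using sub by blast
  then show ?case
  proof cases
    case redundant
    have "card (I - {c}) < card I" using redundant(1) finI by (rule card_Diff1_less[rotated])
    then have "dim_at_most (kernel_space v E (I - {c})) (card (inactive_bases v E r (I - {c})))"
      using sub strict_linear_order_on_subset[OF order] fin by (intro less.hyps) auto
    moreover have "kernel_space v E I \<subseteq> kernel_space v E (I - {c})"
      by (rule kernel_space_antimono) auto
    moreover have "irrefl r" using order by (simp add: strict_linear_order_on_def)
    then have "card (inactive_bases v E r (I - {c})) \<le> card (inactive_bases v E r I)"
      using inactive_bases_redundant[where v = v, OF redundant(2)] finite_inactive_bases[OF fin] by (metis card_mono)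
    ultimately show ?thesis by (rule dim_at_most_mono)
  next
    case loop
    have card: "card (E - {x}) < card E" using loop(1) fin by (rule card_Diff1_less[rotated])
    have "dim_at_most (kernel_space v (E - {x}) I) (card (inactive_bases v (E - {x}) r I))"
      using sub order fin loop card by (intro less.hyps) auto
    moreover have span: "v ` E \<subseteq> span (v ` (E - {x}))"
    proof
      fix w assume "w \<in> v ` E"
      then obtain y where "y \<in> E" "w = v y" by blast
      then show "w \<in> span (v ` (E - {x}))"
        using loop(3) by (cases "y = x") (auto intro: span_base span_zero)
    qed
    have co: "conull_labels v (E - {x}) \<eta> = conull_labels v E \<eta>" for \<eta> using loop(3) by (auto simp: conull_labels_def)
    note facet = facet_normal_delete[where v = v, OF span]
    have "kernel_space v E I \<subseteq> kernel_space v (E - {x}) I"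
    proof
      fix q assume q: "q \<in> kernel_space v E I"
      have "dir_deriv \<eta> q = 0" if "\<forall>y\<in>E - {x}. \<eta> \<bullet> v y = 0" for \<eta>
      proof -
        have "\<forall>y\<in>E. \<eta> \<bullet> v y = 0" using that loop(3) by auto
        then show ?thesis using q by (simp add: kernel_space_def)
      qed
      then show "q \<in> kernel_space v (E - {x}) I"
        using q facet by (simp add: kernel_space_def co)
    qed
    moreover have "inactive_bases v (E - {x}) r I \<subseteq> inactive_bases v E r I"
      using bases_delete_subset[OF span] by (auto simp: inactive_bases_def)
    then have "card (inactive_bases v (E - {x}) r I) \<le> card (inactive_bases v E r I)"
      using finite_inactive_bases[OF fin] by (rule card_mono[rotated])
    ultimately show ?thesis by (metis dim_at_most_mono)
  next
    case contract
    have card: "card (E - {x}) < card E" using contract(1) fin by (rule card_Diff1_less[rotated])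
    show ?thesis
    proof (rule kernel_space_dim_le_contract[where v = v, OF fin contract])
      show "dim_at_most (kernel_space v (E - {x}) I) (card (inactive_bases v (E - {x}) r I))"
        using sub order fin contract card by (intro less.hyps) auto
      show "dim_at_most (kernel_space (perp_proj (v x) \<circ> v) (E - {x}) I)
          (card (inactive_bases (perp_proj (v x) \<circ> v) (E - {x}) r I))"
        using sub order fin contract card by (intro less.hyps) auto
    qed
  next
    case all
    show ?thesis
    proof (cases "I = {}")
      case True
      \<comment> \<open>the empty family has one basis, the empty one\<close>
      have "kernel_space v E I \<subseteq> cpoly.span {1}"
        using constant_of_dir_deriv_0 all(1) True by (auto simp: kernel_space_def)
      moreover have "inactive_bases v E r I = {{}}"
        using all(1) True by (auto simp: inactive_bases_def bases_def lin_indep_def)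
      ultimately show ?thesis
        unfolding dim_at_most_def by (intro exI[of _ "{1}"]) auto
    next
      case False
      obtain b where b: "b \<in> I" "\<And>y. y \<in> I \<Longrightarrow> y \<noteq> b \<Longrightarrow> (b, y) \<in> r" "\<And>y. y \<in> I \<Longrightarrow> (y, b) \<notin> r"
        by (rule finite_strict_order_least[OF order order.refl finI False]) blast
      have later: "{y\<in>I. (b, y) \<in> r} = I - {b}" using b by blast
      obtain \<eta> where \<eta>: "\<And>s. s \<in> v ` (I - {b}) \<Longrightarrow> \<eta> \<bullet> s = 0" "\<eta> \<bullet> v b \<noteq> 0"
        using exists_normal[OF all(2)[OF b(1), unfolded later]] by metis
      have co: "conull_labels v E \<eta> = {b}" and null: "null_labels v E \<eta> = E - {b}"
        using \<eta> b(1) all(1) by (auto simp: conull_labels_def null_labels_def)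
      have "insert b (E - {b}) = E" using b(1) all(1) by auto
      then have "facet_normal v E \<eta>" by (simp add: facet_normal_def co null span_superset)
      then have "(dir_deriv \<eta> ^^ (card (conull_labels v E \<eta>) - 1)) q = 0" if "q \<in> kernel_space v E I" for q
        using that \<eta>(2) b(1) unfolding kernel_space_def by blast
      then have "kernel_space v E I \<subseteq> {0}" by (auto simp: co)
      then show ?thesis
        unfolding dim_at_most_def by (intro exI[of _ "{}"]) auto
    qed
  qed
qed

section \<open>The polynomial spaces, relative to the span\<close>

text \<open>
  $\mathcal P(A)$ for $A\subseteq E$, with full rank measured in the span of \<open>E\<close>; it is zero if \<open>A\<close> has
  smaller rank than \<open>E\<close>.
\<close>

definition zonotopal_space :: "('e \<Rightarrow> real ^ 'n::finite) \<Rightarrow> 'e set \<Rightarrow> 'e set \<Rightarrow> 'n cpoly set" where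
  "zonotopal_space v E A = cpoly.span {prod_form v Y | Y. Y \<subseteq> A \<and> v ` E \<subseteq> span (v ` (A - Y))}"

lemma linear_span_subset:
  assumes T: "Vector_Spaces.linear cscale cscale T" and W: "cpoly.subspace W"
    and G: "\<And>g. g \<in> G \<Longrightarrow> T g \<in> W" and f: "f \<in> cpoly.span G"
  shows "T f \<in> W"
proof -
  interpret T: Vector_Spaces.linear cscale cscale T by (rule T)
  have "T f \<in> cpoly.span (T ` G)" using f T.span_image[of G] by auto
  also have "\<dots> \<subseteq> W" using G by (intro cpoly.span_minimal[OF _ W]) auto
  finally show ?thesis .
qed

lemma prod_form_insert:
  "finite Y \<Longrightarrow> y \<notin> Y \<Longrightarrow> prod_form v (insert y Y) = lin_form (v y) * prod_form v Y"
  by (simp add: prod_form_def)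

text \<open>
  Only the factors that are not constant along $\eta$ can be differentiated, and each of them once.
\<close>

lemma dir_deriv_pow_prod_form_eq_0:
  assumes "finite Y" "card (conull_labels v Y \<eta>) < k"
  shows "(dir_deriv \<eta> ^^ k) (prod_form v Y) = 0"
  using assms
proof (induction Y arbitrary: k rule: finite_induct)
  case empty
  then obtain k' where "k = Suc k'" by (cases k) auto
  then show ?case by (simp add: prod_form_def funpow_swap1)
next
  case (insert y Y)
  show ?case
  proof (cases "\<eta> \<bullet> v y = 0")
    case True
    then have "conull_labels v (insert y Y) \<eta> = conull_labels v Y \<eta>" by (auto simp: conull_labels_def)
    then show ?thesis
      using insert True by (simp add: prod_form_insert dir_deriv_pow_lin_form_mult_orthogonal)
  next
    case False
    then have "conull_labels v (insert y Y) \<eta> = insert y (conull_labels v Y \<eta>)" by (auto simp: conull_labels_def)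
    then have "card (conull_labels v (insert y Y) \<eta>) = Suc (card (conull_labels v Y \<eta>))"
      using insert.hyps by (simp add: conull_labels_def)
    then obtain k' where k: "k = Suc k'" "card (conull_labels v Y \<eta>) < k'"
      using insert.prems by (cases k) auto
    then have "(dir_deriv \<eta> ^^ k') (prod_form v Y) = 0" "(dir_deriv \<eta> ^^ Suc k') (prod_form v Y) = 0"
      using insert.IH[of k'] insert.IH[of "Suc k'"] by auto
    then show ?thesis
      unfolding k(1) prod_form_insert[OF insert.hyps] dir_deriv_pow_lin_form_mult by simp
  qed
qed

lemma dir_deriv_pow_prod_form_top:
  assumes "finite Y"
  shows "\<exists>c. (dir_deriv \<eta> ^^ card (conull_labels v Y \<eta>)) (prod_form v Y) = cscale c (prod_form v (null_labels v Y \<eta>))"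
  using assms
proof (induction Y rule: finite_induct)
  case empty
  show ?case by (intro exI[of _ 1]) (simp add: conull_labels_def null_labels_def)
next
  case (insert y Y)
  then obtain c where c: "(dir_deriv \<eta> ^^ card (conull_labels v Y \<eta>)) (prod_form v Y)
      = cscale c (prod_form v (null_labels v Y \<eta>))" by blast
  show ?case
  proof (cases "\<eta> \<bullet> v y = 0")
    case True
    then have "conull_labels v (insert y Y) \<eta> = conull_labels v Y \<eta>"
      "null_labels v (insert y Y) \<eta> = insert y (null_labels v Y \<eta>)"
      "y \<notin> null_labels v Y \<eta>" "finite (null_labels v Y \<eta>)"
      using insert.hyps by (auto simp: conull_labels_def null_labels_def)
    then show ?thesis
      using insert.hyps c True
      by (intro exI[of _ c])
        (simp add: prod_form_insert dir_deriv_pow_lin_form_mult_orthogonal cscale_mult_right)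
  next
    case False
    then have co: "conull_labels v (insert y Y) \<eta> = insert y (conull_labels v Y \<eta>)"
      and null: "null_labels v (insert y Y) \<eta> = null_labels v Y \<eta>"
      using insert.hyps by (auto simp: conull_labels_def null_labels_def)
    have card: "card (conull_labels v (insert y Y) \<eta>) = Suc (card (conull_labels v Y \<eta>))"
      unfolding co using insert.hyps by (simp add: conull_labels_def)
    have "(dir_deriv \<eta> ^^ Suc (card (conull_labels v Y \<eta>))) (prod_form v Y) = 0"
      using insert.hyps(1) by (intro dir_deriv_pow_prod_form_eq_0) simp_all
    then show ?thesis
      unfolding card null prod_form_insert[OF insert.hyps] dir_deriv_pow_lin_form_mult c
      by (metis add_0 cpoly.scale_scale mult_zero_right)
  qed
qed

lemma conull_labels_Int_nonempty:
  assumes "x \<in> E" "\<eta> \<bullet> v x \<noteq> 0" "v ` E \<subseteq> span (v ` S)"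
  shows "\<exists>z\<in>S. \<eta> \<bullet> v z \<noteq> 0"
proof (rule ccontr)
  assume "\<not> ?thesis"
  moreover have "v x \<in> span (v ` S)" using assms by blast
  ultimately have "\<eta> \<bullet> v x = 0" by (intro inner_eq_0_on_span[of "v ` S" \<eta> "v x"]) auto
  with assms(2) show False by simp
qed

lemma dir_deriv_zonotopal_space_eq_0:
  assumes "finite E" "A \<subseteq> E" "\<And>x. x \<in> E \<Longrightarrow> \<eta> \<bullet> v x = 0" "f \<in> zonotopal_space v E A"
  shows "dir_deriv \<eta> f = 0"
proof -
  have lin: "Vector_Spaces.linear cscale cscale (dir_deriv \<eta>)"
    using linear_dir_deriv_pow[where \<eta> = \<eta> and k = 1] by simp
  have gen: "dir_deriv \<eta> (prod_form v Y) = 0" if "Y \<subseteq> A" for Y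
  proof -
    have "finite Y" "conull_labels v Y \<eta> = {}" using that assms(1-3) finite_subset[of Y E] by (auto simp: conull_labels_def)
    then show ?thesis using dir_deriv_pow_prod_form_eq_0[of Y v \<eta> 1] by simp
  qed
  have "dir_deriv \<eta> f \<in> {0}"
    by (rule linear_span_subset[OF lin cpoly.subspace_single_0 _ assms(4)[unfolded zonotopal_space_def]]) (use gen in auto)
  then show ?thesis by simp
qed

text \<open>
  A generator $p_Y$ leaves out some vector off the hyperplane of $\eta$, since the vectors left out
  span.  So it has fewer than the stated number of factors not constant along $\eta$.
\<close>

lemma dir_deriv_pow_zonotopal_space_eq_0:
  assumes "finite E" "A \<subseteq> E" "x \<in> E" "\<eta> \<bullet> v x \<noteq> 0" "f \<in> zonotopal_space v E A"
  shows "(dir_deriv \<eta> ^^ card (conull_labels v A \<eta>)) f = 0"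
proof -
  have gen: "(dir_deriv \<eta> ^^ card (conull_labels v A \<eta>)) (prod_form v Y) = 0"
    if Y: "Y \<subseteq> A" "v ` E \<subseteq> span (v ` (A - Y))" for Y
  proof -
    have "finite A" by (rule finite_subset[OF assms(2,1)])
    then have fin: "finite Y" "finite (conull_labels v A \<eta>)"
      using finite_subset[OF Y(1)] by (auto simp: conull_labels_def)
    obtain z where "z \<in> A - Y" "\<eta> \<bullet> v z \<noteq> 0"
      using conull_labels_Int_nonempty[where v = v, OF assms(3,4) Y(2)] by blast
    then have "conull_labels v Y \<eta> \<subset> conull_labels v A \<eta>" using Y(1) by (auto simp: conull_labels_def)
    then show ?thesis
      using fin by (intro dir_deriv_pow_prod_form_eq_0 psubset_card_mono)
  qed
  have "(dir_deriv \<eta> ^^ card (conull_labels v A \<eta>)) f \<in> {0}"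
    by (rule linear_span_subset[OF linear_dir_deriv_pow cpoly.subspace_single_0 _ assms(5)[unfolded zonotopal_space_def]]) (use gen in auto)
  then show ?thesis by simp
qed

lemma subspace_zonotopal_space: "cpoly.subspace (zonotopal_space v E A)"
  unfolding zonotopal_space_def by (rule cpoly.subspace_span)

lemma dim_at_least_singleton:
  assumes "w \<in> W" "w \<noteq> 0"
  shows "dim_at_least W 1"
  unfolding dim_at_least_def using assms
  by (intro exI[of _ "{w}"]) (auto simp: cpoly.dependent_single)

lemma loop_in_span_delete:
  assumes "v x = 0"
  shows "v ` E \<subseteq> span (v ` (E - {x}))"
proof
  fix w assume "w \<in> v ` E"
  then obtain y where "y \<in> E" "w = v y" by blast
  then show "w \<in> span (v ` (E - {x}))"
    using assms by (cases "y = x") (auto intro: span_base span_zero)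
qed

text \<open>
  Deletion and contraction on generators: $p_xp_Y$ is a generator for $X$ if $p_Y$ is one for
  $X\setminus x$, and each generator for $X/x$ is the restriction of the generator for $X$ with the
  same index set.
\<close>

lemma zonotopal_space_dim_ge:
  fixes v :: "'e \<Rightarrow> real ^ 'n::finite"
  assumes "finite E"
  shows "dim_at_least (zonotopal_space v E E) (card (bases v E))"
  using assms
proof (induction "card E" arbitrary: v E rule: less_induct)
  case less
  note fin = \<open>finite E\<close>
  show ?case
  proof (cases "E = {}")
    case True
    have "prod_form v {} \<in> zonotopal_space v E E"
      unfolding zonotopal_space_def True by (intro cpoly.span_base) blast
    then have "dim_at_least (zonotopal_space v E E) 1"
      by (rule dim_at_least_singleton) (simp add: prod_form_def)
    moreover have "bases v E = {{}}" using True by (auto simp: bases_def lin_indep_def)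
    ultimately show ?thesis by simp
  next
    case False
    then obtain x where x: "x \<in> E" by blast
    let ?E' = "E - {x}"
    have card: "card ?E' < card E" using x fin by (rule card_Diff1_less[rotated])
    have fin': "finite ?E'" using fin by simp
    note IH = less.hyps[OF card fin']
    show ?thesis
    proof (cases "v x = 0")
      case True
      have sub: "bases v E \<subseteq> bases v ?E'"
      proof
        fix B assume B: "B \<in> bases v E"
        then have "v x \<notin> span (v ` (B - {x}))" if "x \<in> B" using that by (simp add: bases_def lin_indep_def)
        then have "x \<notin> B" using True span_zero by metis
        with B show "B \<in> bases v ?E'" by (auto simp: bases_def)
      qed
      have span: "v ` E \<subseteq> span (v ` (E - Y))" if "v ` ?E' \<subseteq> span (v ` (?E' - Y))" for Y
      proof -
        have "v ` E \<subseteq> span (v ` ?E')" using True by (rule loop_in_span_delete)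
        also have "\<dots> \<subseteq> span (v ` (?E' - Y))" using that by (rule span_minimal) simp
        also have "\<dots> \<subseteq> span (v ` (E - Y))" by (intro span_mono) auto
        finally show ?thesis .
      qed
      then have "zonotopal_space v ?E' ?E' \<subseteq> zonotopal_space v E E"
        unfolding zonotopal_space_def by (intro cpoly.span_mono) blast
      then show ?thesis
        using dim_at_least_mono[OF IH] card_mono[OF finite_bases[OF fin'] sub] by blast
    next
      case nz: False
      let ?v' = "perp_proj (v x) \<circ> v"
      have contract: "dim_at_least (restrict_perp (v x) ` zonotopal_space v E E) (card (bases ?v' ?E'))"
      proof (rule dim_at_least_mono[OF IH])
        interpret T: Vector_Spaces.linear cscale cscale "restrict_perp (v x)"
          by (rule linear_restrict_perp)
        have "prod_form ?v' Y \<in> restrict_perp (v x) ` zonotopal_space v E E"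
          if Y: "Y \<subseteq> ?E'" "?v' ` ?E' \<subseteq> span (?v' ` (?E' - Y))" for Y
        proof -
          have "insert x (?E' - Y) = E - Y" using Y(1) x by auto
          then have "v ` E \<subseteq> span (v ` (E - Y))"
            using Y(2) spanning_insert_iff_contract[of x E v "?E' - Y"] x by simp
          then have "prod_form v Y \<in> zonotopal_space v E E"
            using Y(1) unfolding zonotopal_space_def by (intro cpoly.span_base) blast
          then show ?thesis by (metis image_eqI restrict_perp_prod_form)
        qed
        then show "zonotopal_space ?v' ?E' ?E' \<subseteq> restrict_perp (v x) ` zonotopal_space v E E"
          unfolding zonotopal_space_def[of ?v']
          by (intro cpoly.span_minimal T.subspace_image[OF subspace_zonotopal_space]) blast
      qed simp
      \<comment> \<open>if \<open>x\<close> is a coloop, no basis avoids it\<close>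
      let ?D = "if v ` E \<subseteq> span (v ` ?E') then bases v ?E' else {}"
      have delete: "dim_at_least (zonotopal_space v E E \<inter> {q. restrict_perp (v x) q = 0}) (card ?D)"
      proof (cases "v ` E \<subseteq> span (v ` ?E')")
        case True
        have mult_linear: "Vector_Spaces.linear cscale cscale ((*) (lin_form (v x)))"
          by unfold_locales (simp_all add: distrib_left cscale_mult_right)
        have gen: "lin_form (v x) * prod_form v Y \<in> zonotopal_space v E E"
          if Y: "Y \<subseteq> ?E'" "v ` ?E' \<subseteq> span (v ` (?E' - Y))" for Y
        proof -
          have "finite Y" "x \<notin> Y" using Y(1) fin finite_subset by auto
          then have eq: "lin_form (v x) * prod_form v Y = prod_form v (insert x Y)"
            by (simp add: prod_form_insert)
          have "v ` E \<subseteq> span (v ` ?E')" by (rule True)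
          also have "\<dots> \<subseteq> span (v ` (?E' - Y))" using Y(2) by (rule span_minimal) simp
          also have "?E' - Y = E - insert x Y" by auto
          finally show ?thesis
            unfolding eq zonotopal_space_def using Y(1) x by (intro cpoly.span_base) blast
        qed
        have "lin_form (v x) * f \<in> zonotopal_space v E E" if f: "f \<in> zonotopal_space v ?E' ?E'" for f
          by (rule linear_span_subset[OF mult_linear subspace_zonotopal_space _ f[unfolded zonotopal_space_def]]) (use gen in auto)
        moreover have "restrict_perp (v x) (lin_form (v x) * f) = 0" for f
          by (simp add: restrict_perp_mult restrict_perp_lin_form)
        ultimately have sub: "(*) (lin_form (v x)) ` zonotopal_space v ?E' ?E' \<subseteq> zonotopal_space v E E \<inter> {q. restrict_perp (v x) q = 0}"
          by auto
        have "dim_at_least ((*) (lin_form (v x)) ` zonotopal_space v ?E' ?E') (card (bases v ?E'))"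
          using lin_form_mult_eq_0[OF _ nz] by (rule dim_at_least_injective_image[OF mult_linear _ IH])
        then show ?thesis using True by (intro dim_at_least_mono[OF _ sub]) auto
      next
        case False
        then show ?thesis by (simp add: dim_at_least_0)
      qed
      have "bases v E \<subseteq> insert x ` bases ?v' ?E' \<union> ?D"
      proof
        fix B assume B: "B \<in> bases v E"
        show "B \<in> insert x ` bases ?v' ?E' \<union> ?D"
        proof (cases "x \<in> B")
          case True
          then have "insert x (B - {x}) = B" "B - {x} \<subseteq> ?E'" using B by (auto simp: bases_def)
          then have "B - {x} \<in> bases ?v' ?E'"
            using bases_insert_iff_contract[of E x "B - {x}" v] fin x nz B by simp
          then have "insert x (B - {x}) \<in> insert x ` bases ?v' ?E'" by (rule imageI)
          then show ?thesis using \<open>insert x (B - {x}) = B\<close> by simp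
        next
          case False
          then have "B \<subseteq> ?E'" using B by (auto simp: bases_def)
          moreover have "v ` E \<subseteq> span (v ` ?E')"
            using B span_mono[OF image_mono[OF \<open>B \<subseteq> ?E'\<close>], of v] unfolding bases_def by blast
          ultimately show ?thesis using B by (auto simp: bases_def)
        qed
      qed
      then have "card (bases v E) \<le> card (insert x ` bases ?v' ?E' \<union> ?D)"
        using finite_bases[OF fin'] by (intro card_mono) auto
      also have "\<dots> \<le> card (bases ?v' ?E') + card ?D"
        using card_Un_le[of "insert x ` bases ?v' ?E'" ?D] card_image_le[OF finite_bases[OF fin'], of "insert x" ?v']
        by linarith
      finally show ?thesis
        using dim_at_least_exact[OF linear_restrict_perp subspace_zonotopal_space contract delete]
          dim_at_least_mono by blast
    qed
  qed
qed

lemma zonotopal_space_subset_kernel_space: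
  assumes fin: "finite E" and I: "I \<subseteq> E"
  shows "zonotopal_space v E E \<inter> (\<Inter>b\<in>I. zonotopal_space v E (E - {b})) \<subseteq> kernel_space v E I"
proof
  fix f assume f: "f \<in> zonotopal_space v E E \<inter> (\<Inter>b\<in>I. zonotopal_space v E (E - {b}))"
  show "f \<in> kernel_space v E I"
    unfolding kernel_space_def
  proof (intro CollectI conjI allI impI)
    show "dir_deriv \<eta> f = 0" if "\<forall>x\<in>E. \<eta> \<bullet> v x = 0" for \<eta>
      using that f by (intro dir_deriv_zonotopal_space_eq_0[OF fin order.refl]) auto
  next
    fix \<eta> assume "facet_normal v E \<eta>"
    then obtain x where x: "x \<in> E" "\<eta> \<bullet> v x \<noteq> 0" by (auto simp: facet_normal_def conull_labels_def)
    show "(dir_deriv \<eta> ^^ card (conull_labels v E \<eta>)) f = 0"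
      using f by (intro dir_deriv_pow_zonotopal_space_eq_0[where \<eta> = \<eta> and v = v, OF fin order.refl x]) auto
    assume "\<exists>b\<in>I. \<eta> \<bullet> v b \<noteq> 0"
    then obtain b where b: "b \<in> I" "\<eta> \<bullet> v b \<noteq> 0" by blast
    have zero: "(dir_deriv \<eta> ^^ card (conull_labels v (E - {b}) \<eta>)) f = 0"
      using f b(1) by (intro dir_deriv_pow_zonotopal_space_eq_0[where \<eta> = \<eta> and v = v, OF fin _ x]) auto
    show "(dir_deriv \<eta> ^^ (card (conull_labels v E \<eta>) - 1)) f = 0"
    proof -
      have "conull_labels v (E - {b}) \<eta> = conull_labels v E \<eta> - {b}" "b \<in> conull_labels v E \<eta>"
        using b I by (auto simp: conull_labels_def)
      then show ?thesis using zero by simp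
    qed
  qed
qed

text \<open>
  With no element that could be active, the two dimension bounds coincide.
\<close>

lemma kernel_space_empty_eq_zonotopal_space:
  assumes fin: "finite E"
  shows "kernel_space v E {} = zonotopal_space v E E"
proof -
  have "dim_at_most (kernel_space v E {}) (card (inactive_bases v E {} {}))"
    by (rule kernel_space_dim_le[OF fin])
      (simp_all add: strict_linear_order_on_def trans_def irrefl_def total_on_def)
  moreover have "inactive_bases v E {} {} = bases v E" by (auto simp: inactive_bases_def active_def)
  ultimately have "dim_at_most (kernel_space v E {}) (card (bases v E))" by simp
  with zonotopal_space_dim_ge[OF fin, of v] show ?thesis
    using zonotopal_space_subset_kernel_space[OF fin, of "{}" v]
    by (intro subspace_eq_of_dim[symmetric, where k = "card (bases v E)"] subspace_zonotopal_space) auto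
qed

lemma kernel_space_coloop_eq_0:
  assumes b: "b \<in> I" "b \<in> E" and coloop: "\<not> v ` E \<subseteq> span (v ` (E - {b}))"
    and f: "f \<in> kernel_space v E I"
  shows "f = 0"
proof -
  obtain \<eta> where \<eta>: "facet_normal v E \<eta>" "conull_labels v E \<eta> = {b}"
    by (rule coloop_facet_normal[OF b(2) coloop])
  then have "\<eta> \<bullet> v b \<noteq> 0" by (auto simp: conull_labels_def)
  then have "(dir_deriv \<eta> ^^ (card (conull_labels v E \<eta>) - 1)) f = 0"
    using f \<eta>(1) b(1) unfolding kernel_space_def by blast
  then show ?thesis by (simp add: \<eta>(2))
qed

text \<open>
  By the central case, membership in $\mathcal P(X\setminus b)$ is a system of differential equations
  indexed by the facets of $X\setminus b$.  For a facet avoiding $b$ the exponent is one less than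
  for $X$, which is what the additional generators of $\mathcal I_-(X,I)$ provide, because $b\in I$.
\<close>

lemma kernel_space_eq:
  assumes fin: "finite E" and I: "I \<subseteq> E"
  shows "kernel_space v E I = zonotopal_space v E E \<inter> (\<Inter>b\<in>I. zonotopal_space v E (E - {b}))"
proof
  show "kernel_space v E I \<subseteq> zonotopal_space v E E \<inter> (\<Inter>b\<in>I. zonotopal_space v E (E - {b}))"
  proof
    fix f assume f: "f \<in> kernel_space v E I"
    have "f \<in> zonotopal_space v E (E - {b})" if b: "b \<in> I" for b
    proof (cases "v ` E \<subseteq> span (v ` (E - {b}))")
      case True
      have bE: "b \<in> E" using b I by blast
      have "f \<in> kernel_space v (E - {b}) {}"
        unfolding kernel_space_def
      proof (intro CollectI conjI allI impI)
        fix \<eta> assume \<eta>: "\<forall>x\<in>E - {b}. \<eta> \<bullet> v x = 0"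
        have "v b \<in> span (v ` (E - {b}))" using True bE by blast
        then have "\<eta> \<bullet> v b = 0" by (rule inner_eq_0_on_span[rotated]) (use \<eta> in auto)
        then show "dir_deriv \<eta> f = 0" using \<eta> f unfolding kernel_space_def by blast
      next
        fix \<eta> assume "facet_normal v (E - {b}) \<eta>"
        then have \<eta>: "facet_normal v E \<eta>" by (rule facet_normal_delete[OF True])
        show "(dir_deriv \<eta> ^^ card (conull_labels v (E - {b}) \<eta>)) f = 0"
        proof (cases "\<eta> \<bullet> v b = 0")
          case True
          then have "conull_labels v (E - {b}) \<eta> = conull_labels v E \<eta>" by (auto simp: conull_labels_def)
          then show ?thesis using f \<eta> by (simp add: kernel_space_def)
        next
          case False
          then have "conull_labels v (E - {b}) \<eta> = conull_labels v E \<eta> - {b}" "b \<in> conull_labels v E \<eta>"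
            using bE by (auto simp: conull_labels_def)
          then have "card (conull_labels v (E - {b}) \<eta>) = card (conull_labels v E \<eta>) - 1" by simp
          then show ?thesis using f \<eta> b False unfolding kernel_space_def by auto
        qed
      qed simp
      then have "f \<in> zonotopal_space v (E - {b}) (E - {b})"
        using kernel_space_empty_eq_zonotopal_space[of "E - {b}" v] fin by simp
      also have "v ` E \<subseteq> span (v ` (E - {b} - Y))" if "v ` (E - {b}) \<subseteq> span (v ` (E - {b} - Y))" for Y
        using True span_minimal[OF that] by auto
      then have "zonotopal_space v (E - {b}) (E - {b}) \<subseteq> zonotopal_space v E (E - {b})"
        unfolding zonotopal_space_def by (intro cpoly.span_mono) blast
      finally show ?thesis .
    next
      case False
      then have "f = 0" using b I f by (intro kernel_space_coloop_eq_0[of b I E v]) auto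
      then show ?thesis by (simp add: cpoly.subspace_0[OF subspace_zonotopal_space])
    qed
    moreover have "f \<in> zonotopal_space v E E"
      using f kernel_space_antimono[of "{}" I v E] kernel_space_empty_eq_zonotopal_space[OF fin, of v] by auto
    ultimately show "f \<in> zonotopal_space v E E \<inter> (\<Inter>b\<in>I. zonotopal_space v E (E - {b}))" by blast
  qed
qed (rule zonotopal_space_subset_kernel_space[OF fin I])

section \<open>The dimension of the semi-internal space\<close>

lemma dim_at_least_kernels:
  assumes "finite Z" and W: "cpoly.subspace W" and W_ge: "dim_at_least W l"
    and "\<And>z. z \<in> Z \<Longrightarrow> Vector_Spaces.linear cscale cscale (T z)"
    and "\<And>z. z \<in> Z \<Longrightarrow> dim_at_most (T z ` W) (k z)"
  shows "dim_at_least (W \<inter> {w. \<forall>z\<in>Z. T z w = 0}) (l - (\<Sum>z\<in>Z. k z))"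
  using assms(1,4,5)
proof (induction Z rule: finite_induct)
  case empty
  then show ?case using W_ge by simp
next
  case (insert z Z)
  let ?V = "W \<inter> {w. \<forall>z\<in>Z. T z w = 0}"
  have ker: "cpoly.subspace {w. T y w = 0}" if "y \<in> Z" for y
  proof -
    interpret T: Vector_Spaces.linear cscale cscale "T y" using insert.prems(1) that by blast
    show ?thesis by (rule T.subspace_kernel)
  qed
  have "?V = W \<inter> (\<Inter>y\<in>Z. {w. T y w = 0})" by auto
  then have "cpoly.subspace ?V"
    using ker by (auto intro!: cpoly.subspace_inter[OF W] cpoly.subspace_Inter)
  moreover have "dim_at_most (T z ` ?V) (k z)"
    by (rule dim_at_most_mono[OF insert.prems(2)[of z]]) auto
  moreover have "dim_at_least ?V (l - (\<Sum>z\<in>Z. k z))" using insert by auto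
  ultimately have "dim_at_least (?V \<inter> {w. T z w = 0}) (l - (\<Sum>z\<in>Z. k z) - k z)"
    using insert.prems(1)[of z] by (intro dim_at_least_kernel) auto
  then show ?case
    by (rule dim_at_least_mono) (use insert.hyps in auto)
qed

lemma span_insert_transversal:
  fixes b :: "'a::real_inner"
  assumes "y \<in> span (insert b S)" "\<eta> \<bullet> y = 0" "\<eta> \<bullet> b \<noteq> 0" "\<And>s. s \<in> S \<Longrightarrow> \<eta> \<bullet> s = 0"
  shows "y \<in> span S"
proof -
  obtain k where k: "y - k *\<^sub>R b \<in> span S" using assms(1) span_breakdown_eq by blast
  then have "\<eta> \<bullet> (y - k *\<^sub>R b) = 0" using assms(4) by (rule inner_eq_0_on_span[rotated])
  then have "k = 0" using assms(2,3) by (simp add: inner_diff_right)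
  with k show ?thesis by simp
qed

text \<open>
  By the exchange property, any element off the facet completes it to the full span.
\<close>

lemma facet_normal_spanning:
  assumes \<eta>: "facet_normal v E \<eta>" and z: "z \<in> conull_labels v E \<eta>"
  shows "v ` E \<subseteq> span (v ` insert z (null_labels v E \<eta>))"
proof -
  let ?N = "null_labels v E \<eta>"
  obtain y where y: "v ` E \<subseteq> span (v ` insert y ?N)" using \<eta> by (auto simp: facet_normal_def)
  have "v z \<notin> span (v ` ?N)"
  proof
    assume "v z \<in> span (v ` ?N)"
    then have "\<eta> \<bullet> v z = 0" by (rule inner_eq_0_on_span[rotated]) (auto simp: null_labels_def)
    with z show False by (simp add: conull_labels_def)
  qed
  moreover have "v z \<in> span (insert (v y) (v ` ?N))" using y z by (auto simp: conull_labels_def)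
  ultimately have "v y \<in> span (v ` insert z ?N)" by (simp add: in_span_insert)
  then have "v ` insert y ?N \<subseteq> span (v ` insert z ?N)" by (auto intro: span_base)
  then show ?thesis using y span_minimal[of "v ` insert y ?N" "span (v ` insert z ?N)"] by auto
qed

text \<open>
  Two normals of the same facet are proportional up to a vector orthogonal to the whole family, and
  derivatives along the latter vanish on all powers of derivatives of \<open>q\<close>.
\<close>

lemma dir_deriv_pow_proportional:
  assumes q: "\<And>w. (\<And>x. x \<in> E \<Longrightarrow> w \<bullet> v x = 0) \<Longrightarrow> dir_deriv w q = 0"
    and \<eta>: "facet_normal v E \<eta>" and null: "null_labels v E \<eta> = null_labels v E \<theta>"
    and zero: "(dir_deriv \<theta> ^^ m) q = 0"
  shows "(dir_deriv \<eta> ^^ m) q = 0"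
proof -
  obtain y where y: "y \<in> conull_labels v E \<eta>" "v ` E \<subseteq> span (v ` insert y (null_labels v E \<eta>))"
    using \<eta> by (auto simp: facet_normal_def)
  have "\<theta> \<bullet> v y \<noteq> 0" using y(1) null by (auto simp: conull_labels_def null_labels_def)
  define k where "k = (\<eta> \<bullet> v y) / (\<theta> \<bullet> v y)"
  define w where "w = \<eta> - k *\<^sub>R \<theta>"
  have orth: "w \<bullet> s = 0" if s: "s \<in> v ` insert y (null_labels v E \<eta>)" for s
  proof -
    obtain u where u: "s = v u" "u = y \<or> u \<in> null_labels v E \<eta>" using s by blast
    show ?thesis
    proof (cases "u = y")
      case True
      then show ?thesis using \<open>\<theta> \<bullet> v y \<noteq> 0\<close> by (simp add: u(1) w_def k_def inner_diff_left)
    next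
      case False
      then have "u \<in> null_labels v E \<eta>" "u \<in> null_labels v E \<theta>" using u(2) null by auto
      then show ?thesis by (simp add: u(1) w_def inner_diff_left null_labels_def)
    qed
  qed
  have "w \<bullet> v x = 0" if x: "x \<in> E" for x
  proof -
    have "v x \<in> span (v ` insert y (null_labels v E \<eta>))" using y(2) x by blast
    then show ?thesis by (rule inner_eq_0_on_span[rotated]) (rule orth)
  qed
  then have w: "dir_deriv w q = 0" by (rule q)
  have comm: "dir_deriv w ((dir_deriv \<theta> ^^ j) q) = 0" for j
  proof -
    have "dir_deriv w ((dir_deriv \<theta> ^^ j) q) = diff_op (lin_form w * lin_form \<theta> ^ j) q"
      by (simp only: diff_op_mult diff_op_lin_form diff_op_lin_form_pow)
    also have "\<dots> = diff_op (lin_form \<theta> ^ j * lin_form w) q"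
      by (simp only: mult.commute)
    also have "\<dots> = 0"
      by (simp only: diff_op_mult diff_op_lin_form w diff_op_0_right)
    finally show ?thesis .
  qed
  have "dir_deriv \<eta> p = dir_deriv w p + cscale (complex_of_real k) (dir_deriv \<theta> p)" for p
    by (simp add: w_def dir_deriv_def cpoly.scale_sum_right cpoly.scale_left_diff_distrib sum_subtractf)
  then have "(dir_deriv \<eta> ^^ j) q = cscale (complex_of_real k ^ j) ((dir_deriv \<theta> ^^ j) q)" for j
    by (induction j) (simp_all add: dir_deriv_cscale comm mult.commute)
  then show ?thesis by (simp add: zero)
qed

text \<open>
  On a generator $p_Y$ the operator $D_\eta^{m(F)-1}$ gives zero unless $Y$ omits exactly one vector
  $z$ off the facet $F$.  In that case the result is a multiple of $p_{Y\cap F}$, and the vectors of $F$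
  that $Y$ omits span $F$, because together with $z$ they span everything.
\<close>

lemma dir_deriv_pow_zonotopal_space:
  assumes fin: "finite E" and x: "x \<in> conull_labels v E \<eta>" and A: "A \<subseteq> E" "conull_labels v E \<eta> \<subseteq> A"
    and f: "f \<in> zonotopal_space v E A"
  shows "(dir_deriv \<eta> ^^ (card (conull_labels v E \<eta>) - 1)) f
    \<in> zonotopal_space v (null_labels v E \<eta>) (A \<inter> null_labels v E \<eta>)"
proof -
  let ?N = "null_labels v E \<eta>" and ?k = "card (conull_labels v E \<eta>) - 1"
  have gen: "(dir_deriv \<eta> ^^ ?k) (prod_form v Y) \<in> zonotopal_space v ?N (A \<inter> ?N)"
    if Y: "Y \<subseteq> A" "v ` E \<subseteq> span (v ` (A - Y))" for Y
  proof -
    have finY: "finite Y" "finite (conull_labels v E \<eta>)"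
      using Y(1) A(1) fin finite_subset[of Y E] by (auto simp: conull_labels_def)
    obtain z where z: "z \<in> A - Y" "\<eta> \<bullet> v z \<noteq> 0"
      using conull_labels_Int_nonempty[where v = v and \<eta> = \<eta>, OF _ _ Y(2)] x by (auto simp: conull_labels_def)
    then have zco: "z \<in> conull_labels v E \<eta>" using A(1) by (auto simp: conull_labels_def)
    have sub: "conull_labels v Y \<eta> \<subseteq> conull_labels v E \<eta> - {z}" using Y(1) A(1) z by (auto simp: conull_labels_def)
    have card_z: "card (conull_labels v E \<eta> - {z}) = ?k" using zco by simp
    show ?thesis
    proof (cases "card (conull_labels v Y \<eta>) < ?k")
      case True
      then show ?thesis
        using finY cpoly.subspace_0[OF subspace_zonotopal_space] by (simp add: dir_deriv_pow_prod_form_eq_0)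
    next
      case False
      moreover have "card (conull_labels v Y \<eta>) \<le> ?k"
        unfolding card_z[symmetric] using sub finY(2) by (intro card_mono) auto
      ultimately have "card (conull_labels v Y \<eta>) = card (conull_labels v E \<eta> - {z})"
        unfolding card_z by simp
      then have eq: "conull_labels v Y \<eta> = conull_labels v E \<eta> - {z}"
        using sub finY(2) by (intro card_subset_eq) auto
      then have k: "?k = card (conull_labels v Y \<eta>)" using card_z by simp
      obtain c where c: "(dir_deriv \<eta> ^^ ?k) (prod_form v Y) = cscale c (prod_form v (null_labels v Y \<eta>))"
        unfolding k using dir_deriv_pow_prod_form_top[OF finY(1)] by blast
      have AY: "A - Y = insert z (A \<inter> ?N - null_labels v Y \<eta>)"
        using eq z A Y(1) by (auto simp: null_labels_def conull_labels_def)
      have "v ` ?N \<subseteq> span (v ` (A \<inter> ?N - null_labels v Y \<eta>))"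
      proof
        fix w assume "w \<in> v ` ?N"
        then have "w \<in> span (insert (v z) (v ` (A \<inter> ?N - null_labels v Y \<eta>)))" "\<eta> \<bullet> w = 0"
          using Y(2) unfolding AY by (auto simp: null_labels_def)
        then show "w \<in> span (v ` (A \<inter> ?N - null_labels v Y \<eta>))"
          using z(2) by (rule span_insert_transversal) (auto simp: null_labels_def)
      qed
      moreover have "null_labels v Y \<eta> \<subseteq> A \<inter> ?N" using Y(1) A(1) by (auto simp: null_labels_def)
      ultimately have "prod_form v (null_labels v Y \<eta>) \<in> zonotopal_space v ?N (A \<inter> ?N)"
        unfolding zonotopal_space_def by (intro cpoly.span_base) blast
      then show ?thesis unfolding c by (rule cpoly.subspace_scale[OF subspace_zonotopal_space])
    qed
  qed
  show ?thesis
    by (rule linear_span_subset[OF linear_dir_deriv_pow subspace_zonotopal_space _ f[unfolded zonotopal_space_def]]) (use gen in auto)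
qed

lemma dir_deriv_pow_kernel_space:
  assumes fin: "finite E" and \<eta>: "facet_normal v E \<eta>" and J: "J \<subseteq> null_labels v E \<eta>"
    and f: "f \<in> kernel_space v E J"
  shows "(dir_deriv \<eta> ^^ (card (conull_labels v E \<eta>) - 1)) f \<in> kernel_space v (null_labels v E \<eta>) J"
proof -
  let ?N = "null_labels v E \<eta>"
  obtain x where x: "x \<in> conull_labels v E \<eta>" using \<eta> by (auto simp: facet_normal_def)
  have JE: "J \<subseteq> E" and finN: "finite ?N" using J fin by (auto simp: null_labels_def)
  have f': "f \<in> zonotopal_space v E E" "\<And>b. b \<in> J \<Longrightarrow> f \<in> zonotopal_space v E (E - {b})"
    using f kernel_space_eq[OF fin JE, of v] by auto
  have N: "E \<inter> ?N = ?N" "(E - {b}) \<inter> ?N = ?N - {b}" for b by (auto simp: null_labels_def)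
  have co: "conull_labels v E \<eta> \<subseteq> E" "conull_labels v E \<eta> \<subseteq> E - {b}" if "b \<in> J" for b
    using that J by (auto simp: conull_labels_def null_labels_def)
  have "(dir_deriv \<eta> ^^ (card (conull_labels v E \<eta>) - 1)) f \<in> zonotopal_space v ?N ?N"
    using dir_deriv_pow_zonotopal_space[OF fin x order.refl _ f'(1)] by (simp add: N conull_labels_def)
  moreover have "(dir_deriv \<eta> ^^ (card (conull_labels v E \<eta>) - 1)) f \<in> zonotopal_space v ?N (?N - {b})" if "b \<in> J" for b
    using dir_deriv_pow_zonotopal_space[OF fin x _ co(2)[OF that] f'(2)[OF that]] by (simp add: N)
  ultimately show ?thesis by (simp add: kernel_space_eq[OF finN J])
qed

lemma lin_indep_insert:
  assumes "lin_indep v B" "v b \<notin> span (v ` B)"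
  shows "lin_indep v (insert b B)"
proof -
  have b: "v b \<notin> v ` B" using assms(2) span_base[of "v b" "v ` B"] by blast
  have B: "inj_on v B" "independent (v ` B)" using assms(1) by (simp_all add: lin_indep_iff)
  have "independent (insert (v b) (v ` B))" using assms(2) B(2) by (rule independent_insertI)
  moreover have "inj_on v (insert b B)" using B(1) b by (auto simp: inj_on_insert)
  ultimately show ?thesis by (simp add: lin_indep_iff)
qed

text \<open>
  Let $F$ be a facet containing $J$ but not $b$.  The elements that decide about activity in an
  inactive basis of $X\cap F$ lie in $J\subseteq F$, and adding $b\notin F$ does not enlarge the traces
  on $F$ of the spans involved.  But $b$ itself becomes active once it belongs to $I$, since all of $J$
  lies in the hyperplane $F$ spanned by the other basis elements.
\<close>

lemma inactive_bases_insert_least: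
  assumes b: "b \<in> E" "b \<notin> J" "\<And>y. y \<in> J \<Longrightarrow> (y, b) \<notin> r" "(b, b) \<notin> r"
    and \<eta>: "facet_normal v E \<eta>" "J \<subseteq> null_labels v E \<eta>" "\<eta> \<bullet> v b \<noteq> 0"
    and B: "B \<in> inactive_bases v (null_labels v E \<eta>) r J"
  shows "insert b B \<in> inactive_bases v E r J - inactive_bases v E r (insert b J)"
proof -
  let ?N = "null_labels v E \<eta>"
  have B': "B \<subseteq> ?N" "lin_indep v B" "v ` ?N \<subseteq> span (v ` B)"
    using B by (auto simp: inactive_bases_def bases_def)
  have orth: "\<eta> \<bullet> v x = 0" if "x \<in> ?N" for x using that by (simp add: null_labels_def)
  have bN: "b \<notin> ?N" using \<eta>(3) orth by blast
  then have bB: "b \<notin> B" using B'(1) by blast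
  have "v b \<notin> span (v ` B)"
  proof
    assume "v b \<in> span (v ` B)"
    then have "\<eta> \<bullet> v b = 0" by (rule inner_eq_0_on_span[rotated]) (use orth B'(1) in auto)
    with \<eta>(3) show False by simp
  qed
  then have ind: "lin_indep v (insert b B)" by (rule lin_indep_insert[OF B'(2)])
  have "v ` E \<subseteq> span (v ` insert b ?N)"
    using b(1) \<eta>(3) by (intro facet_normal_spanning[OF \<eta>(1)]) (simp add: conull_labels_def)
  also have "v ` insert b ?N \<subseteq> span (v ` insert b B)"
    using B'(3) span_mono[of "v ` B" "v ` insert b B"] by (auto intro: span_base)
  then have "span (v ` insert b ?N) \<subseteq> span (v ` insert b B)" by (rule span_minimal) simp
  finally have basis: "insert b B \<in> bases v E"
    using ind b(1) B'(1) by (auto simp: bases_def null_labels_def)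
  have "\<not> active v r J (insert b B) a" if a: "a \<in> insert b B" for a
  proof
    assume act: "active v r J (insert b B) a"
    then have "a \<noteq> b" "a \<in> B" using a b(2) by (auto simp: active_def)
    then have eq: "insert b B - {a} = insert b (B - {a})" by auto
    have "v y \<in> span (v ` (B - {a}))" if y: "y \<in> J" "(a, y) \<in> r" for y
    proof (rule span_insert_transversal)
      show "v y \<in> span (insert (v b) (v ` (B - {a})))"
        using act y by (simp add: active_def eq)
      show "\<eta> \<bullet> v y = 0" using y(1) \<eta>(2) orth by blast
      show "\<eta> \<bullet> v b \<noteq> 0" by (rule \<eta>(3))
      show "\<And>s. s \<in> v ` (B - {a}) \<Longrightarrow> \<eta> \<bullet> s = 0" using orth B'(1) by auto
    qed
    then have "active v r J B a" using act by (auto simp: active_def)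
    with B \<open>a \<in> B\<close> show False by (auto simp: inactive_bases_def)
  qed
  then have internal: "insert b B \<in> inactive_bases v E r J" using basis by (simp add: inactive_bases_def)
  have "insert b B - {b} = B" using bB by auto
  then have "active v r (insert b J) (insert b B) b"
    using b(4) \<eta>(2) B'(3) by (auto simp: active_def)
  with internal show ?thesis by (auto simp: inactive_bases_def)
qed

lemma inactive_bases_antimono_least:
  assumes "\<And>y. y \<in> J \<Longrightarrow> (y, b) \<notin> r"
  shows "inactive_bases v E r (insert b J) \<subseteq> inactive_bases v E r J"
  using assms by (auto simp: inactive_bases_def active_def)

text \<open>
  A facet is determined by any of its bases; this makes the families of bases disjoint in the count
  for \<open>kernel_space_dim_ge\<close>.
\<close>

lemma null_labels_eq_span:
  assumes "B \<in> bases v (null_labels v E \<eta>)"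
  shows "null_labels v E \<eta> = {x\<in>E. v x \<in> span (v ` B)}"
proof -
  have B: "B \<subseteq> null_labels v E \<eta>" "v ` null_labels v E \<eta> \<subseteq> span (v ` B)"
    using assms by (auto simp: bases_def)
  have "\<eta> \<bullet> v x = 0" if "v x \<in> span (v ` B)" for x
    using that by (rule inner_eq_0_on_span[rotated]) (use B(1) in \<open>auto simp: null_labels_def\<close>)
  with B(2) show ?thesis by (auto simp: null_labels_def)
qed

text \<open>
  Induction that adds to \<open>J\<close> an element \<open>b\<close> smaller than all of \<open>J\<close>.  Each facet through \<open>J\<close> that
  avoids \<open>b\<close> imposes one new system of conditions, at most as many as there are inactive bases of the
  facet, and every such basis extends by \<open>b\<close> to a basis lost in the step from \<open>J\<close> to \<open>I\<close>.
\<close>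

lemma kernel_space_dim_ge:
  fixes v :: "'e \<Rightarrow> real ^ 'n::finite"
  assumes fin: "finite E" and "I \<subseteq> E" "strict_linear_order_on I r"
  shows "dim_at_least (kernel_space v E I) (card (inactive_bases v E r I))"
  using assms(2,3)
proof (induction "card I" arbitrary: I)
  case 0
  then have "I = {}" using fin finite_subset by fastforce
  then show ?case
    using zonotopal_space_dim_ge[OF fin, of v] kernel_space_empty_eq_zonotopal_space[OF fin, of v]
    by (simp add: inactive_bases_def active_def)
next
  case (Suc n)
  have finI: "finite I" using fin Suc.prems(1) finite_subset by blast
  have irrefl: "irrefl r" using Suc.prems(2) by (simp add: strict_linear_order_on_def)
  have "I \<noteq> {}" using Suc.hyps(2) by auto
  then obtain b where b: "b \<in> I" "\<And>y. y \<in> I \<Longrightarrow> (y, b) \<notin> r"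
    using finite_strict_order_least[OF Suc.prems(2) order.refl finI] by metis
  define J where "J = I - {b}"
  have I: "I = insert b J" "b \<notin> J" using b(1) by (auto simp: J_def)
  have JE: "J \<subseteq> E" and bE: "b \<in> E" using I Suc.prems(1) by auto
  have orderJ: "strict_linear_order_on J r"
    by (rule strict_linear_order_on_subset[OF Suc.prems(2)]) (auto simp: J_def)
  have "n = card J" using Suc.hyps(2) b(1) finI by (simp add: J_def)
  then have J_ge: "dim_at_least (kernel_space v E J) (card (inactive_bases v E r J))"
    using JE orderJ by (rule Suc.hyps(1))
  \<comment> \<open>the facets, given by their label sets, whose conditions are new in passing from \<open>J\<close> to \<open>I\<close>\<close>
  define Fs where "Fs = {null_labels v E \<eta> | \<eta>. facet_normal v E \<eta> \<and> J \<subseteq> null_labels v E \<eta> \<and> b \<notin> null_labels v E \<eta>}"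
  have FsE: "Fs \<subseteq> Pow E" by (auto simp: Fs_def null_labels_def)
  then have finFs: "finite Fs" using fin finite_subset by blast
  have "\<exists>\<eta>. facet_normal v E \<eta> \<and> J \<subseteq> Z \<and> b \<notin> Z \<and> Z = null_labels v E \<eta>" if "Z \<in> Fs" for Z
    using that by (auto simp: Fs_def)
  then obtain \<theta> where \<theta>: "facet_normal v E (\<theta> Z)" "J \<subseteq> Z" "b \<notin> Z" "Z = null_labels v E (\<theta> Z)"
    if "Z \<in> Fs" for Z by metis
  define T where "T Z = dir_deriv (\<theta> Z) ^^ (card (conull_labels v E (\<theta> Z)) - 1)" for Z
  have linear_T: "Vector_Spaces.linear cscale cscale (T Z)" for Z
    unfolding T_def by (rule linear_dir_deriv_pow)
  have im: "dim_at_most (T Z ` kernel_space v E J) (card (inactive_bases v Z r J))" if Z: "Z \<in> Fs" for Z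
  proof (rule dim_at_most_mono)
    have "finite Z" using Z FsE fin finite_subset by blast
    then show "dim_at_most (kernel_space v Z J) (card (inactive_bases v Z r J))"
      using \<theta>(2)[OF Z] orderJ by (rule kernel_space_dim_le)
    show "T Z ` kernel_space v E J \<subseteq> kernel_space v Z J"
      using dir_deriv_pow_kernel_space[OF fin \<theta>(1)[OF Z], of J] \<theta>(2,4)[OF Z] by (auto simp: T_def)
  qed simp
  \<comment> \<open>a facet that contains \<open>J\<close> but not \<open>I\<close> avoids \<open>b\<close>, so its condition is among the new ones\<close>
  have ker: "kernel_space v E J \<inter> {f. \<forall>Z\<in>Fs. T Z f = 0} \<subseteq> kernel_space v E I"
  proof
    fix f assume f: "f \<in> kernel_space v E J \<inter> {f. \<forall>Z\<in>Fs. T Z f = 0}"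
    have "(dir_deriv \<eta> ^^ (card (conull_labels v E \<eta>) - 1)) f = 0"
      if \<eta>: "facet_normal v E \<eta>" "\<exists>x\<in>I. \<eta> \<bullet> v x \<noteq> 0" for \<eta>
    proof (cases "\<exists>x\<in>J. \<eta> \<bullet> v x \<noteq> 0")
      case True
      then show ?thesis using f \<eta>(1) by (auto simp: kernel_space_def)
    next
      case False
      let ?Z = "null_labels v E \<eta>"
      have "J \<subseteq> ?Z" "b \<notin> ?Z" using False \<eta>(2) I(1) JE by (auto simp: null_labels_def)
      then have Z: "?Z \<in> Fs" using \<eta>(1) by (auto simp: Fs_def)
      have null: "null_labels v E \<eta> = null_labels v E (\<theta> ?Z)" by (rule \<theta>(4)[OF Z])
      then have co: "conull_labels v E \<eta> = conull_labels v E (\<theta> ?Z)" by (auto simp: null_labels_def conull_labels_def)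
      have "(dir_deriv (\<theta> ?Z) ^^ (card (conull_labels v E \<eta>) - 1)) f = 0"
        using f Z by (auto simp: T_def co)
      then show ?thesis
        by (rule dir_deriv_pow_proportional[OF _ \<eta>(1) null, rotated]) (use f in \<open>simp add: kernel_space_def\<close>)
    qed
    then show "f \<in> kernel_space v E I" using f by (auto simp: kernel_space_def)
  qed
  have count: "(\<Sum>Z\<in>Fs. card (inactive_bases v Z r J)) + card (inactive_bases v E r I) \<le> card (inactive_bases v E r J)"
  proof -
    let ?U = "\<Union>Z\<in>Fs. insert b ` inactive_bases v Z r J"
    have notb: "b \<notin> B" if "Z \<in> Fs" "B \<in> inactive_bases v Z r J" for Z B
      using that \<theta>(3) by (auto simp: inactive_bases_def bases_def)
    have "inj_on (insert b) (inactive_bases v Z r J)" if "Z \<in> Fs" for Z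
    proof (rule inj_onI)
      fix B C assume "B \<in> inactive_bases v Z r J" "C \<in> inactive_bases v Z r J" "insert b B = insert b C"
      then show "B = C" using notb[OF that] by (metis insert_ident)
    qed
    then have "card (insert b ` inactive_bases v Z r J) = card (inactive_bases v Z r J)" if "Z \<in> Fs" for Z
      using that card_image by blast
    moreover have "insert b ` inactive_bases v Z r J \<inter> insert b ` inactive_bases v Y r J = {}"
      if ZY: "Z \<in> Fs" "Y \<in> Fs" "Z \<noteq> Y" for Z Y
    proof (rule ccontr)
      assume "insert b ` inactive_bases v Z r J \<inter> insert b ` inactive_bases v Y r J \<noteq> {}"
      then obtain B C where BC: "B \<in> inactive_bases v Z r J" "C \<in> inactive_bases v Y r J" "insert b B = insert b C"
        by blast
      then have eq: "B = C" using notb ZY by (metis insert_ident)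
      have "Z = {x\<in>E. v x \<in> span (v ` B)}"
        using null_labels_eq_span[of B v E "\<theta> Z"] BC(1) \<theta>(4)[OF ZY(1)] by (simp add: inactive_bases_def)
      moreover have "Y = {x\<in>E. v x \<in> span (v ` B)}"
        using null_labels_eq_span[of C v E "\<theta> Y"] BC(2) \<theta>(4)[OF ZY(2)] eq by (simp add: inactive_bases_def)
      ultimately show False using ZY(3) by simp
    qed
    moreover have finZ: "finite (inactive_bases v Z r J)" if "Z \<in> Fs" for Z
      using that FsE fin finite_subset by (intro finite_inactive_bases) blast
    ultimately have "card ?U = (\<Sum>Z\<in>Fs. card (inactive_bases v Z r J))"
      using finFs by (subst card_UN_disjoint) auto
    moreover have "?U \<subseteq> inactive_bases v E r J - inactive_bases v E r I"
    proof
      fix C assume "C \<in> ?U"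
      then obtain Z B where Z: "Z \<in> Fs" and B: "B \<in> inactive_bases v Z r J" "C = insert b B" by blast
      have "\<theta> Z \<bullet> v b \<noteq> 0" using \<theta>(3,4)[OF Z] bE by (auto simp: null_labels_def)
      moreover have "(b, b) \<notin> r" "\<And>y. y \<in> J \<Longrightarrow> (y, b) \<notin> r" using b I(1) by auto
      ultimately show "C \<in> inactive_bases v E r J - inactive_bases v E r I"
        unfolding B(2) I(1)
        using \<theta>(1,2,4)[OF Z] B(1) bE I(2) by (intro inactive_bases_insert_least[where \<eta> = "\<theta> Z"]) auto
    qed
    then have "card ?U \<le> card (inactive_bases v E r J - inactive_bases v E r I)"
      by (rule card_mono[OF finite_Diff[OF finite_inactive_bases[OF fin]]])
    moreover have "inactive_bases v E r I \<subseteq> inactive_bases v E r J"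
      unfolding I(1) using b(2) I(1) by (intro inactive_bases_antimono_least) auto
    then have "card (inactive_bases v E r J - inactive_bases v E r I) + card (inactive_bases v E r I) = card (inactive_bases v E r J)"
      using card_Diff_subset[OF finite_inactive_bases[OF fin], of v r I "inactive_bases v E r J"]
        card_mono[OF finite_inactive_bases[OF fin], of "inactive_bases v E r I" v r J] by simp
    ultimately show ?thesis by linarith
  qed
  have "dim_at_least (kernel_space v E J \<inter> {f. \<forall>Z\<in>Fs. T Z f = 0})
      (card (inactive_bases v E r J) - (\<Sum>Z\<in>Fs. card (inactive_bases v Z r J)))"
    by (rule dim_at_least_kernels[OF finFs subspace_kernel_space J_ge])
      (simp_all add: im linear_T)
  then show ?case
    by (rule dim_at_least_mono[OF _ ker]) (use count in linarith)
qed

section \<open>The spaces and ideals of a spanning family\<close>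

lemma subset_span_iff_full:
  assumes "span (v ` E) = UNIV"
  shows "v ` E \<subseteq> span S \<longleftrightarrow> span S = UNIV"
  using assms span_minimal[of "v ` E" "span S"] by auto

lemma P_space_eq_zonotopal_space:
  fixes v :: "'e \<Rightarrow> real ^ 'n::finite"
  assumes "span (v ` E) = UNIV"
  shows "P_space v A = zonotopal_space v E A"
proof -
  have "vrank v S = CARD('n) \<longleftrightarrow> v ` E \<subseteq> span (v ` S)" for S
    using dim_eq_full[of "v ` S"] subset_span_iff_full[OF assms, of "v ` S"] by (simp add: vrank_def)
  then show ?thesis by (simp add: P_space_def zonotopal_space_def)
qed

lemma P_minus_eq:
  fixes v :: "'e \<Rightarrow> real ^ 'n::finite"
  assumes span: "span (v ` E) = UNIV"
  shows "P_minus v E I = zonotopal_space v E E \<inter> (\<Inter>b\<in>I. zonotopal_space v E (E - {b}))"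
proof -
  have "zonotopal_space v E (E - {b}) \<subseteq> zonotopal_space v E E" for b
  proof -
    have "v ` E \<subseteq> span (v ` (E - Y))" if "v ` E \<subseteq> span (v ` (E - {b} - Y))" for Y
      using that span_mono[of "v ` (E - {b} - Y)" "v ` (E - Y)"] by blast
    then show ?thesis unfolding zonotopal_space_def by (intro cpoly.span_mono) blast
  qed
  then show ?thesis
    by (auto simp: P_minus_def P_space_eq_zonotopal_space[OF span])
qed

text \<open>
  An element outside $I$ precedes $b\in I$, so maximality of $b$ in the complement of a hyperplane is
  a condition on the elements of $I$ only; for them totality of the order turns ``all elements of the
  complement precede $b$'' into ``no larger element lies in the complement''.
\<close>

lemma internal_bases_eq_inactive_bases:
  assumes span: "span (v ` E) = UNIV" and I: "I \<subseteq> E"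
    and order: "strict_linear_order_on E r" and last: "\<forall>x\<in>E - I. \<forall>y\<in>I. (x, y) \<in> r"
  shows "internal_bases v E r I = inactive_bases v E r I"
proof -
  have r: "trans r" "irrefl r" "total_on E r" using order by (auto simp: strict_linear_order_on_def)
  then have asym: "(y, b) \<notin> r" if "(b, y) \<in> r" for b y using that by (metis irrefl_def transD)
  have bases: "basis_subsets v E = bases v E"
    by (auto simp: basis_subsets_def indep_subsets_def bases_def lin_indep_iff subset_span_iff_full[OF span])
  have "internally_active v E r I B b \<longleftrightarrow> active v r I B b" if B: "B \<in> bases v E" "b \<in> B" for B b
  proof
    assume act: "internally_active v E r I B b"
    have "v y \<in> span (v ` (B - {b}))" if y: "y \<in> I" "(b, y) \<in> r" for y
    proof (rule ccontr)
      assume "v y \<notin> span (v ` (B - {b}))"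
      then have "y \<in> outside v E (span (v ` (B - {b})))" using y(1) I by (auto simp: outside_def)
      moreover have "y \<noteq> b" using y(2) asym by blast
      ultimately have "(y, b) \<in> r" using act by (simp add: internally_active_def)
      with asym[OF y(2)] show False by blast
    qed
    with act show "active v r I B b" by (simp add: active_def internally_active_def)
  next
    assume act: "active v r I B b"
    then have bI: "b \<in> I" by (simp add: active_def)
    have "b \<in> outside v E (span (v ` (B - {b})))"
      using B by (auto simp: outside_def bases_def lin_indep_def)
    moreover have "(y, b) \<in> r" if y: "y \<in> outside v E (span (v ` (B - {b})))" "y \<noteq> b" for y
    proof (cases "y \<in> I")
      case True
      then have "(b, y) \<notin> r" using act y(1) by (auto simp: active_def outside_def)
      then show ?thesis using r(3) y bI I by (auto simp: total_on_def outside_def)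
    next
      case False
      then show ?thesis using last y(1) bI by (auto simp: outside_def)
    qed
    ultimately show "internally_active v E r I B b"
      using bI by (simp add: internally_active_def)
  qed
  then show ?thesis by (auto simp: internal_bases_def inactive_bases_def bases)
qed

lemma facet_eq_hyperplane:
  fixes v :: "'e \<Rightarrow> real ^ 'n::finite"
  assumes F: "F \<in> facets v E" and eta: "facet_normals v E eta"
  shows "F = {x. eta F \<bullet> x = 0}"
proof (rule subspace_dim_equal)
  have nz: "eta F \<noteq> 0" and perp: "\<forall>x\<in>F. eta F \<bullet> x = 0" using F eta by (auto simp: facet_normals_def)
  show "subspace F" using F by (simp add: facets_def)
  show "subspace {x. eta F \<bullet> x = 0}" by (rule subspace_hyperplane)
  show "F \<subseteq> {x. eta F \<bullet> x = 0}" using perp by blast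
  show "dim {x. eta F \<bullet> x = 0} \<le> dim F" using dim_hyperplane[OF nz] F by (simp add: facets_def)
qed

text \<open>
  A facet has codimension one, so it equals the hyperplane orthogonal to its normal, and any vector of
  the family off the facet completes it to the full space.
\<close>

lemma facet_facet_normal:
  fixes v :: "'e \<Rightarrow> real ^ 'n::finite"
  assumes span: "span (v ` E) = UNIV" and F: "F \<in> facets v E" and eta: "facet_normals v E eta"
  shows "facet_normal v E (eta F)" "conull_labels v E (eta F) = outside v E F"
    "null_labels v E (eta F) = {x\<in>E. v x \<in> F}"
proof -
  note hyp = facet_eq_hyperplane[OF F eta]
  have nz: "eta F \<noteq> 0" using F eta by (auto simp: facet_normals_def)
  show "conull_labels v E (eta F) = outside v E F" "null_labels v E (eta F) = {x\<in>E. v x \<in> F}"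
    by (subst (2) hyp, simp add: conull_labels_def outside_def null_labels_def)+
  obtain Y where Y: "Y \<subseteq> E" "F = span (v ` Y)" using F by (auto simp: facets_def)
  have "\<exists>x\<in>E. eta F \<bullet> v x \<noteq> 0"
  proof (rule ccontr)
    assume "\<not> ?thesis"
    moreover have "eta F \<in> span (v ` E)" using span by simp
    ultimately have "eta F \<bullet> eta F = 0"
      by (intro inner_eq_0_on_span[where S = "v ` E" and \<eta> = "eta F" and y = "eta F"]) auto
    with nz show False by simp
  qed
  then obtain x where x: "x \<in> E" "eta F \<bullet> v x \<noteq> 0" by blast
  have "Y \<subseteq> null_labels v E (eta F)"
    using Y(1) span_base[of _ "v ` Y"] hyp Y(2) by (auto simp: null_labels_def)
  then have sub: "F \<subseteq> span (v ` null_labels v E (eta F))" unfolding Y(2) by (intro span_mono image_mono)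
  have "z \<in> span (insert (v x) (v ` null_labels v E (eta F)))" for z
  proof -
    let ?k = "(eta F \<bullet> z) / (eta F \<bullet> v x)"
    have "eta F \<bullet> (z - ?k *\<^sub>R v x) = 0" using x(2) by (simp add: inner_diff_right)
    then have "z - ?k *\<^sub>R v x \<in> F" by (subst hyp) simp
    then show ?thesis unfolding span_breakdown_eq using sub by blast
  qed
  then have "v ` E \<subseteq> span (v ` insert x (null_labels v E (eta F)))" by auto
  then show "facet_normal v E (eta F)"
    unfolding facet_normal_def using x by (intro bexI[of _ x]) (auto simp: conull_labels_def)
qed

lemma facet_normal_facet:
  fixes v :: "'e \<Rightarrow> real ^ 'n::finite"
  assumes span: "span (v ` E) = UNIV" and \<eta>: "facet_normal v E \<eta>"
  obtains F where "F \<in> facets v E" "F = {x. \<eta> \<bullet> x = 0}"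
proof -
  let ?N = "null_labels v E \<eta>"
  obtain x where x: "x \<in> E" "\<eta> \<bullet> v x \<noteq> 0" "v ` E \<subseteq> span (v ` insert x ?N)"
    using \<eta> by (auto simp: facet_normal_def conull_labels_def)
  have full: "span (v ` insert x ?N) = UNIV"
    using x(3) subset_span_iff_full[OF span] by blast
  have "span (v ` ?N) = {z. \<eta> \<bullet> z = 0}"
  proof
    show "span (v ` ?N) \<subseteq> {z. \<eta> \<bullet> z = 0}"
      by (rule span_minimal[OF _ subspace_hyperplane]) (auto simp: null_labels_def)
    show "{z. \<eta> \<bullet> z = 0} \<subseteq> span (v ` ?N)"
    proof
      fix z assume "z \<in> {z. \<eta> \<bullet> z = 0}"
      then have "z \<in> span (insert (v x) (v ` ?N))" "\<eta> \<bullet> z = 0" using full by auto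
      then show "z \<in> span (v ` ?N)"
        using x(2) by (rule span_insert_transversal) (auto simp: null_labels_def)
    qed
  qed
  moreover have "\<eta> \<noteq> 0" using x(2) by auto
  then have "dim {z. \<eta> \<bullet> z = 0} = CARD('n) - 1" by (simp add: dim_hyperplane)
  ultimately have "dim (span (v ` ?N)) = CARD('n) - 1" by (simp only:)
  moreover have "?N \<subseteq> E" by (auto simp: null_labels_def)
  ultimately have "span (v ` ?N) \<in> facets v E"
    unfolding facets_def using subspace_span by blast
  with \<open>span (v ` ?N) = {z. \<eta> \<bullet> z = 0}\<close> that show thesis by blast
qed

text \<open>
  The kernel of an ideal only depends on its generators.  Passing from the chosen normals to all
  normals is harmless by \<open>dir_deriv_pow_proportional\<close>.
\<close>

lemma ideal_ker_I_minus:
  fixes v :: "'e \<Rightarrow> real ^ 'n::finite"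
  assumes span: "span (v ` E) = UNIV" and I: "I \<subseteq> E" and eta: "facet_normals v E eta"
  shows "ideal_ker (I_minus v E eta I) = kernel_space v E I"
proof -
  have ideal: "q \<in> ideal_ker (I_minus v E eta I) \<longleftrightarrow>
      (\<forall>F\<in>facets v E. (dir_deriv (eta F) ^^ facet_mult v E F) q = 0) \<and>
      (\<forall>F\<in>facets_not_containing v E I. (dir_deriv (eta F) ^^ (facet_mult v E F - 1)) q = 0)" for q
  proof -
    have "q \<in> ideal_ker (I_minus v E eta I) \<longleftrightarrow>
        q \<in> ideal_ker (I_ideal v E eta) \<and>
        (\<forall>F\<in>facets_not_containing v E I. (dir_deriv (eta F) ^^ (facet_mult v E F - 1)) q = 0)"
      unfolding I_minus_def ideal_ker_generated_ideal ideal_ker_def[of "I_ideal v E eta"]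
      by (auto simp: diff_op_lin_form_pow ball_Un)
    also have "q \<in> ideal_ker (I_ideal v E eta) \<longleftrightarrow>
        (\<forall>F\<in>facets v E. (dir_deriv (eta F) ^^ facet_mult v E F) q = 0)"
      unfolding I_ideal_def ideal_ker_generated_ideal by (auto simp: diff_op_lin_form_pow)
    finally show ?thesis .
  qed
  have mult: "facet_mult v E F = card (conull_labels v E (eta F))" if "F \<in> facets v E" for F
    using facet_facet_normal(2)[OF span that eta] by (simp add: facet_mult_def)
  have meets: "F \<in> facets_not_containing v E I \<longleftrightarrow> (\<exists>x\<in>I. eta F \<bullet> v x \<noteq> 0)" if F: "F \<in> facets v E" for F
  proof -
    have "y \<in> F \<longleftrightarrow> eta F \<bullet> y = 0" for y using facet_eq_hyperplane[OF F eta] by blast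
    then show ?thesis using F by (auto simp: facets_not_containing_def)
  qed
  show ?thesis
  proof (intro equalityI subsetI)
    fix q assume q: "q \<in> kernel_space v E I"
    show "q \<in> ideal_ker (I_minus v E eta I)"
      unfolding ideal
    proof (intro conjI ballI)
      fix F assume F: "F \<in> facets v E"
      show "(dir_deriv (eta F) ^^ facet_mult v E F) q = 0"
        using q facet_facet_normal(1)[OF span F eta] by (simp add: kernel_space_def mult[OF F])
    next
      fix F assume F': "F \<in> facets_not_containing v E I"
      then have F: "F \<in> facets v E" by (simp add: facets_not_containing_def)
      show "(dir_deriv (eta F) ^^ (facet_mult v E F - 1)) q = 0"
        using q facet_facet_normal(1)[OF span F eta] F' meets[OF F]
        by (simp add: kernel_space_def mult[OF F])
    qed
  next
    fix q assume "q \<in> ideal_ker (I_minus v E eta I)"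
    then have q: "\<And>F. F \<in> facets v E \<Longrightarrow> (dir_deriv (eta F) ^^ facet_mult v E F) q = 0"
      "\<And>F. F \<in> facets_not_containing v E I \<Longrightarrow> (dir_deriv (eta F) ^^ (facet_mult v E F - 1)) q = 0"
      unfolding ideal by blast+
    have perp: "dir_deriv \<eta> q = 0" if \<eta>: "\<And>x. x \<in> E \<Longrightarrow> \<eta> \<bullet> v x = 0" for \<eta>
    proof -
      have "\<eta> \<in> span (v ` E)" using span by simp
      then have "\<eta> \<bullet> \<eta> = 0" by (rule inner_eq_0_on_span[rotated]) (use \<eta> in auto)
      then show ?thesis by (simp add: dir_deriv_def)
    qed
    have "(dir_deriv \<eta> ^^ card (conull_labels v E \<eta>)) q = 0 \<and>
        ((\<exists>x\<in>I. \<eta> \<bullet> v x \<noteq> 0) \<longrightarrow> (dir_deriv \<eta> ^^ (card (conull_labels v E \<eta>) - 1)) q = 0)"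
      if \<eta>: "facet_normal v E \<eta>" for \<eta>
    proof -
      obtain F where F: "F \<in> facets v E" "F = {x. \<eta> \<bullet> x = 0}" by (rule facet_normal_facet[OF span \<eta>])
      have same: "\<eta> \<bullet> x = 0 \<longleftrightarrow> eta F \<bullet> x = 0" for x
        using F(2) facet_eq_hyperplane[OF F(1) eta] by blast
      then have null: "null_labels v E \<eta> = null_labels v E (eta F)"
        and co: "card (conull_labels v E \<eta>) = facet_mult v E F"
        unfolding mult[OF F(1)] by (auto simp: null_labels_def conull_labels_def)
      have "(\<exists>x\<in>I. \<eta> \<bullet> v x \<noteq> 0) \<longrightarrow> F \<in> facets_not_containing v E I"
        using meets[OF F(1)] same by auto
      then show ?thesis
        unfolding co using q F(1) dir_deriv_pow_proportional[of E v q \<eta> "eta F", OF perp \<eta> null] by blast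
    qed
    then show "q \<in> kernel_space v E I" using perp by (simp add: kernel_space_def)
  qed
qed

theorem theorem3p4:
  fixes v :: "'e \<Rightarrow> real ^ 'n::finite"
    and E I :: "'e set"
    and r :: "('e \<times> 'e) set"
    and eta :: "(real ^ 'n) set \<Rightarrow> real ^ 'n"
  assumes "finite E"
    and "\<forall>x\<in>E. v x \<noteq> 0"
    and "span (v ` E) = UNIV"
    and "I \<in> indep_subsets v E"
    and "strict_linear_order_on E r"
    and "\<forall>x\<in>E - I. \<forall>y\<in>I. (x, y) \<in> r"
    and "facet_normals v E eta"
  shows "cpoly.dim (P_minus v E I) = card (internal_bases v E r I)
       \<and> P_minus v E I = ideal_ker (I_minus v E eta I)"
proof -
  have I: "I \<subseteq> E" using assms(4) by (simp add: indep_subsets_def)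
  have order: "strict_linear_order_on I r" by (rule strict_linear_order_on_subset[OF assms(5) I])
  have P: "P_minus v E I = kernel_space v E I"
    by (simp only: P_minus_eq[OF assms(3)] kernel_space_eq[OF assms(1) I])
  have "cpoly.dim (kernel_space v E I) = card (inactive_bases v E r I)"
    by (rule dim_eqI[OF kernel_space_dim_le[OF assms(1) I order] kernel_space_dim_ge[OF assms(1) I order]])
  then show ?thesis
    by (simp only: P internal_bases_eq_inactive_bases[OF assms(3) I assms(5,6)] ideal_ker_I_minus[OF assms(3) I assms(7)])
qed

end
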